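(* Let $m,n$ be integers with $m \geq n \geq 3$, and let $C_m \square C_n$ be the Cartesian product of the cycles of orders $m$ and $n$. If $m=n=3$, or if $m$ is even and $n=4$, then $\zeta(C_m \square C_n)=3$. Otherwise, $\zeta(C_m \square C_n)=2$.
   Context: The localization game on a connected graph $G$ is played by a Cop controlling $k$ cops and a Robber. The Robber first chooses a vertex $r$, unknown to the Cop. In each turn the Cop probes a set $B=\{b_1,\dots,b_k\}$ of $k$ vertices (repetitions across turns allowed) and receives the distance vector $[d_G(r,b_1),\dots,d_G(r,b_k)]$. If the Cop can determine $r$ exactly, the Cop wins; otherwise the Robber may stay at $r$ or move to a neighbour of $r$, and the next turn begins. The Cop wins if the Robber is located after finitely many turns. The localization number $\zeta(G)$ is the least positive integer $k$ such that the Cop has a winning strategy with $k$ cops against every Robber strategy. $\square$ denotes the Cartesian product of graphs. *)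

theory Defs
  imports "Graph_Theory.Graph_Theory"
begin

text \<open>Undirected simple graphs are represented by their symmetric arc relation, as in the locale
  \<^locale>\<open>pair_graph\<close>.\<close>

text \<open>Intended for \<open>n \<ge> 3\<close>.\<close>
definition cycle_graph :: "nat \<Rightarrow> nat pair_pre_digraph" where
  "cycle_graph n =
     \<lparr> pverts = {..<n},
       parcs = {(i, j). i < n \<and> j < n \<and> (j = Suc i mod n \<or> i = Suc j mod n)} \<rparr>"

definition cartesian_prod ::
    "'a pair_pre_digraph \<Rightarrow> 'b pair_pre_digraph \<Rightarrow> ('a \<times> 'b) pair_pre_digraph"
    (infixr "\<box>" 75) where
  "G \<box> H =
     \<lparr> pverts = pverts G \<times> pverts H,
       parcs = {((u, v), (u', v')).
          u = u' \<and> u \<in> pverts G \<and> (v, v') \<in> parcs H \<or>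
          v = v' \<and> v \<in> pverts H \<and> (u, u') \<in> parcs G} \<rparr>"

lemma pair_graph_cycle_graph:
  assumes "n \<ge> 3"
  shows "pair_graph (cycle_graph n)"
proof unfold_locales
  show "finite (parcs (cycle_graph n))"
    by (rule finite_subset[of _ "{..<n} \<times> {..<n}"]) (auto simp: cycle_graph_def)
  show "symmetric (with_proj (cycle_graph n))"
    by (auto simp: symmetric_def cycle_graph_def intro!: symI)
  show "fst e \<noteq> snd e" if "e \<in> parcs (cycle_graph n)" for e
    using that assms by (auto simp: cycle_graph_def mod_Suc split: if_splits)
qed (auto simp: cycle_graph_def)

lemma pair_graph_cartesian_prod:
  assumes "pair_graph G" and "pair_graph H"
  shows "pair_graph (G \<box> H)"
proof -
  interpret G: pair_graph G by fact
  interpret H: pair_graph H by fact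
  have wf: "fst e \<in> pverts (G \<box> H)" "snd e \<in> pverts (G \<box> H)" if "e \<in> parcs (G \<box> H)" for e
    using that by (auto simp: cartesian_prod_def dest: G.wellformed' H.wellformed')
  have fin: "finite (pverts (G \<box> H))"
    using G.pair_finite_verts H.pair_finite_verts by (simp add: cartesian_prod_def)
  show ?thesis
  proof unfold_locales
    show "finite (parcs (G \<box> H))"
      by (rule finite_subset[of _ "pverts (G \<box> H) \<times> pverts (G \<box> H)"])
        (use wf fin in \<open>force+\<close>)
    show "symmetric (with_proj (G \<box> H))"
      using G.pair_sym_arcs H.pair_sym_arcs
      by (auto simp: symmetric_def cartesian_prod_def intro!: symI dest: symD)
    show "fst e \<noteq> snd e" if "e \<in> parcs (G \<box> H)" for e
      using that G.pair_no_loops H.pair_no_loops by (fastforce simp: cartesian_prod_def)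
  qed (use wf fin in auto)
qed

text \<open>The graph distance is the shortest-path cost for unit arc weights.\<close>
definition graph_dist :: "'a pair_pre_digraph \<Rightarrow> 'a \<Rightarrow> 'a \<Rightarrow> ereal" where
  "graph_dist G u v = wf_digraph.\<mu> (with_proj G) (\<lambda>_. 1) u v"

text \<open>A Cop strategy maps the distance vectors received so far (oldest first) to the next probe.
  The earlier probes need not be recorded, as they are determined by these vectors and the strategy.
  A probe is a repetition-free list enumerating the probed set.\<close>
type_synonym 'a cop_strategy = "ereal list list \<Rightarrow> 'a list"

definition valid_cop_strategy :: "'a pair_pre_digraph \<Rightarrow> nat \<Rightarrow> 'a cop_strategy \<Rightarrow> bool" where
  "valid_cop_strategy G k \<sigma> \<longleftrightarrow>
     (\<forall>h. distinct (\<sigma> h) \<and> length (\<sigma> h) = k \<and> set (\<sigma> h) \<subseteq> pverts G)"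

text \<open>\<open>r t\<close> is the position of the Robber when the probe of turn \<open>t\<close> (counted from \<open>0\<close>) is made.
  Against a fixed deterministic Cop strategy, every Robber strategy, even one that reacts to the
  probes, results in such a walk, and every such walk results from a Robber strategy; so
  quantifying over Robber strategies is quantifying over walks.\<close>
definition robber_walk :: "'a pair_pre_digraph \<Rightarrow> (nat \<Rightarrow> 'a) \<Rightarrow> bool" where
  "robber_walk G r \<longleftrightarrow>
     (\<forall>t. r t \<in> pverts G) \<and> (\<forall>t. r (Suc t) = r t \<or> (r t, r (Suc t)) \<in> parcs G)"

text \<open>The distance vectors received in the turns before turn \<open>t\<close>.\<close>
primrec answers ::
    "'a pair_pre_digraph \<Rightarrow> 'a cop_strategy \<Rightarrow> (nat \<Rightarrow> 'a) \<Rightarrow> nat \<Rightarrow> ereal list list" where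
  "answers G \<sigma> r 0 = []"
| "answers G \<sigma> r (Suc t) =
     answers G \<sigma> r t @ [map (graph_dist G (r t)) (\<sigma> (answers G \<sigma> r t))]"

text \<open>After the probe of turn \<open>t\<close> the Cop can determine the Robber's position: all Robber walks
  consistent with everything the Cop has been told are at the same vertex in turn \<open>t\<close>.\<close>
definition located ::
    "'a pair_pre_digraph \<Rightarrow> 'a cop_strategy \<Rightarrow> (nat \<Rightarrow> 'a) \<Rightarrow> nat \<Rightarrow> bool" where
  "located G \<sigma> r t \<longleftrightarrow>
     (\<forall>r'. robber_walk G r' \<and> answers G \<sigma> r' (Suc t) = answers G \<sigma> r (Suc t) \<longrightarrow> r' t = r t)"

definition cops_win :: "'a pair_pre_digraph \<Rightarrow> nat \<Rightarrow> bool" where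
  "cops_win G k \<longleftrightarrow>
     (\<exists>\<sigma>. valid_cop_strategy G k \<sigma> \<and> (\<forall>r. robber_walk G r \<longrightarrow> (\<exists>t. located G \<sigma> r t)))"

definition localization_number :: "'a pair_pre_digraph \<Rightarrow> nat" where
  "localization_number G = (LEAST k. k \<ge> 1 \<and> cops_win G k)"

end

theory Submission
  imports Defs "HOL-Number_Theory.Cong"
begin

text \<open>
  Lifting vertices to \<open>\<int> \<times> \<int>\<close>, the distance is the sum of two cyclic distances.

  If \<open>m = 2k + 1\<close>, probing \<open>(0, 0)\<close> and \<open>(k, 0)\<close> reveals the first coordinate exactly (the parity of the
  sum of the answers tells the half of the cycle) and the second one up to sign; if the other cycle
  has length at least 4, two probes on opposite sides of the known column then tell apart all ten
  positions to which the Robber can move. If both lengths are even, two antipodal probes in a row reveal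
  both coordinates up to sign. Repeating this from one of the four candidates leaves, by parity, two
  vertices at distance 2 on a line, and for lengths at least 6 two further turns finish. With three
  cops the remaining cases take at most two turns.

  The Robber evades one cop because the five vertices of a closed neighbourhood receive at most
  three answers. On the \<open>3 \<times> 3\<close> torus two probes have at most six answers, while two candidates
  always spread to at least seven. For even \<open>m\<close> and \<open>n = 4\<close> any two probes confuse two of the four vertices
  \<open>(x, y \<plusminus> 1)\<close>, \<open>(x + 1, y)\<close>, \<open>(x + 1, y + 2)\<close>, and the neighbourhoods of these two again contain such a
  quadruple.
\<close>

section \<open>Distances certified by potential functions\<close>

text \<open>Along a walk to \<open>a\<close> the potential loses at most 1 per arc, so
  \<open>f u\<close> bounds the length of every such walk from below. Following strictly decreasing
  arcs yields a walk of length at most \<open>f u\<close>.\<close>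

lemma graph_dist_eqI:
  fixes f :: "'a \<Rightarrow> nat"
  assumes "pair_graph G" "u \<in> pverts G" "f a = 0"
    and lip: "\<And>v w. (v, w) \<in> parcs G \<Longrightarrow> f v \<le> Suc (f w)"
    and descent: "\<And>v. v \<in> pverts G \<Longrightarrow> v \<noteq> a \<Longrightarrow> \<exists>w. (v, w) \<in> parcs G \<and> f w < f v"
  shows "graph_dist G u a = ereal (real (f u))"
proof -
  interpret pair_graph G by fact
  have lower: "f v \<le> length p" if "awalk v p a" for v p
    using that
  proof (induction p arbitrary: v)
    case Nil
    then show ?case by (simp add: awalk_Nil_iff \<open>f a = 0\<close>)
  next
    case (Cons e p)
    from Cons.prems have e: "e \<in> parcs G" "v = fst e" "awalk (snd e) p a"
      by (simp_all add: awalk_Cons_iff)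
    from e(1,2) have "f v \<le> Suc (f (snd e))" by (intro lip) simp
    also have "f (snd e) \<le> length p" by (rule Cons.IH) fact
    finally show ?case by simp
  qed
  have upper: "\<exists>p. awalk v p a \<and> length p \<le> f v" if "v \<in> pverts G" for v
    using that
  proof (induction "f v" arbitrary: v rule: less_induct)
    case less
    show ?case
    proof (cases "v = a")
      case True
      then show ?thesis using less.prems by (intro exI[of _ "[]"]) (simp add: awalk_Nil_iff)
    next
      case False
      then obtain w where w: "(v, w) \<in> parcs G" "f w < f v" using descent less.prems by blast
      then obtain p where "awalk w p a" "length p \<le> f w"
        using less.hyps[of w] wellformed'[of v w] by blast
      then show ?thesis using w by (intro exI[of _ "(v, w) # p"]) (simp add: awalk_Cons_iff)
    qed
  qed
  have cost: "awalk_cost (\<lambda>_. 1) p = real (length p)" for p :: "('a \<times> 'a) list"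
    by (simp add: awalk_cost_def sum_list_triv)
  show ?thesis
    unfolding graph_dist_def
  proof (rule antisym)
    obtain p where p: "awalk u p a" "length p \<le> f u" using upper assms(2) by blast
    have "\<mu> (\<lambda>_. 1) u a \<le> ereal (awalk_cost (\<lambda>_. 1) p)" by (rule min_cost_le_walk_cost) (rule p)
    also have "\<dots> \<le> ereal (real (f u))" using p by (simp add: cost)
    finally show "\<mu> (\<lambda>_. 1) u a \<le> ereal (real (f u))" .
    show "ereal (real (f u)) \<le> \<mu> (\<lambda>_. 1) u a"
      unfolding \<mu>_def by (rule INF_greatest) (auto simp: cost dest: lower)
  qed
qed

subsection \<open>Winning and losing sets of candidate positions\<close>

definition closed_nbhd :: "'a pair_pre_digraph \<Rightarrow> 'a set \<Rightarrow> 'a set" where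
  "closed_nbhd G S = {v. \<exists>u\<in>S. v = u \<or> (u, v) \<in> parcs G}"

definition valid_probe :: "'a pair_pre_digraph \<Rightarrow> nat \<Rightarrow> 'a list \<Rightarrow> bool" where
  "valid_probe G k B \<longleftrightarrow> distinct B \<and> length B = k \<and> set B \<subseteq> pverts G"

definition answer :: "'a pair_pre_digraph \<Rightarrow> 'a list \<Rightarrow> 'a \<Rightarrow> ereal list" where
  "answer G B u = map (graph_dist G u) B"

text \<open>The set \<open>S\<close> consists of the possible Robber positions just before a probe.\<close>
inductive cop_wins_from :: "'a pair_pre_digraph \<Rightarrow> nat \<Rightarrow> 'a set \<Rightarrow> bool" for G k where
  probe: "valid_probe G k B \<Longrightarrow>
    (\<forall>u. u \<in> S \<longrightarrow> (\<forall>v\<in>S. answer G B v = answer G B u \<longrightarrow> v = u) \<or>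
      cop_wins_from G k (closed_nbhd G {v \<in> S. answer G B v = answer G B u})) \<Longrightarrow>
    cop_wins_from G k S"

lemma closed_nbhd_mono: "S \<subseteq> T \<Longrightarrow> closed_nbhd G S \<subseteq> closed_nbhd G T"
  by (auto simp: closed_nbhd_def)

text \<open>The same probes still win from fewer candidates, since every answer class
  shrinks.\<close>

lemma cop_wins_from_antimono:
  assumes "cop_wins_from G k S" "T \<subseteq> S"
  shows "cop_wins_from G k T"
  using assms
proof (induction arbitrary: T)
  case (probe B S)
  show ?case
  proof (rule cop_wins_from.probe[OF probe(1)], intro allI impI)
    fix u assume "u \<in> T"
    then have "u \<in> S" using probe.prems by blast
    have sub: "closed_nbhd G {v \<in> T. answer G B v = answer G B u}
        \<subseteq> closed_nbhd G {v \<in> S. answer G B v = answer G B u}"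
      using probe.prems by (intro closed_nbhd_mono) auto
    with \<open>u \<in> S\<close> show "(\<forall>v\<in>T. answer G B v = answer G B u \<longrightarrow> v = u) \<or>
      cop_wins_from G k (closed_nbhd G {v \<in> T. answer G B v = answer G B u})"
      using probe.IH probe.prems by blast
  qed
qed

text \<open>An answer class may be replaced by any convenient superset \<open>X\<close>; concrete
  strategies are checked in this form.\<close>

lemma cop_wins_fromI:
  assumes "valid_probe G k B"
    and "\<And>u. u \<in> S \<Longrightarrow> (\<forall>v\<in>S. answer G B v = answer G B u \<longrightarrow> v = u) \<or>
      (\<exists>X. cop_wins_from G k (closed_nbhd G X) \<and>
           (\<forall>v\<in>S. answer G B v = answer G B u \<longrightarrow> v \<in> X))"
  shows "cop_wins_from G k S"
proof (rule cop_wins_from.probe[OF assms(1)], intro allI impI)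
  fix u assume "u \<in> S"
  moreover have "cop_wins_from G k (closed_nbhd G {v \<in> S. answer G B v = answer G B u})"
    if "cop_wins_from G k (closed_nbhd G X)" "\<forall>v\<in>S. answer G B v = answer G B u \<longrightarrow> v \<in> X" for X
    by (rule cop_wins_from_antimono[OF that(1)]) (use that(2) in \<open>auto intro!: closed_nbhd_mono\<close>)
  ultimately show "(\<forall>v\<in>S. answer G B v = answer G B u \<longrightarrow> v = u) \<or>
      cop_wins_from G k (closed_nbhd G {v \<in> S. answer G B v = answer G B u})"
    using assms(2) by blast
qed

section \<open>From game trees to strategies\<close>

text \<open>\<open>answers\<close> unfolds at the last turn, but induction over the game tree needs
  the first turn split off. The rest of the play follows the strategy that already knows the first
  answer.\<close>

lemma answers_Suc_shift:
  "answers G \<sigma> r (Suc t) =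
    answer G (\<sigma> []) (r 0) #
      answers G (\<lambda>h. \<sigma> (answer G (\<sigma> []) (r 0) # h)) (\<lambda>i. r (Suc i)) t"
  by (induction t) (simp_all add: answer_def)

lemma answers_Suc: "answers G \<sigma> r (Suc t) = answers G \<sigma> r t @ [answer G (\<sigma> (answers G \<sigma> r t)) (r t)]"
  by (simp add: answer_def)

lemma robber_walk_Suc: "robber_walk G r \<Longrightarrow> robber_walk G (\<lambda>i. r (Suc i))"
  by (simp add: robber_walk_def)

lemma robber_walk_nbhd: "robber_walk G r \<Longrightarrow> r t \<in> S \<Longrightarrow> r (Suc t) \<in> closed_nbhd G S"
  by (auto simp: robber_walk_def closed_nbhd_def)

text \<open>The winning condition of \<open>cops_win\<close> under the additional knowledge that the
  Robber starts in \<open>S\<close>, which restricts the true walk and its rivals alike.\<close>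

definition winning_strategy_from where
  "winning_strategy_from G \<sigma> S \<longleftrightarrow> (\<forall>r. robber_walk G r \<and> r 0 \<in> S \<longrightarrow>
      (\<exists>t. \<forall>r'. robber_walk G r' \<and> r' 0 \<in> S \<and>
        answers G \<sigma> r' (Suc t) = answers G \<sigma> r (Suc t) \<longrightarrow> r' t = r t))"

text \<open>Induction over the game tree: the first probe is \<open>B\<close>, and after the answer
  \<open>a\<close> a strategy \<open>\<tau> a\<close> for the resulting candidates takes
  over.\<close>

lemma cop_wins_from_strategy:
  assumes "cop_wins_from G k S"
  shows "\<exists>\<sigma>. valid_cop_strategy G k \<sigma> \<and> winning_strategy_from G \<sigma> S"
  using assms
proof induction
  case (probe B S)
  let ?C = "\<lambda>u. {v \<in> S. answer G B v = answer G B u}"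
  let ?Q = "\<lambda>a \<sigma>. valid_cop_strategy G k \<sigma> \<and> (\<forall>u\<in>S. answer G B u = a \<longrightarrow>
      (\<forall>v\<in>S. answer G B v = answer G B u \<longrightarrow> v = u) \<or>
      winning_strategy_from G \<sigma> (closed_nbhd G (?C u)))"
  have "\<exists>\<sigma>. ?Q a \<sigma>" for a
  proof (cases "\<exists>u\<in>S. answer G B u = a \<and> \<not> (\<forall>v\<in>S. answer G B v = answer G B u \<longrightarrow> v = u)")
    case True
    then obtain u where u: "u \<in> S" "answer G B u = a"
      "\<not> (\<forall>v\<in>S. answer G B v = answer G B u \<longrightarrow> v = u)" by blast
    then obtain \<sigma> where "valid_cop_strategy G k \<sigma>" "winning_strategy_from G \<sigma> (closed_nbhd G (?C u))"
      using probe.IH by blast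
    then show ?thesis using u(2) by auto
  next
    case False
    \<comment> \<open>After an answer that leaves no doubt, any valid strategy serves as a
      default.\<close>
    have "valid_cop_strategy G k (\<lambda>_. B)"
      using probe.hyps by (simp add: valid_probe_def valid_cop_strategy_def)
    with False show ?thesis by blast
  qed
  then obtain \<tau> where \<tau>: "\<And>a. ?Q a (\<tau> a)" using choice[of ?Q] by blast
  define \<sigma> where "\<sigma> = (\<lambda>h. case h of [] \<Rightarrow> B | a # h' \<Rightarrow> \<tau> a h')"
  have valid: "valid_cop_strategy G k \<sigma>"
    using \<tau> probe.hyps
    by (auto simp: valid_probe_def valid_cop_strategy_def \<sigma>_def split: list.split)
  have shift: "answers G \<sigma> r (Suc t) =
      answer G B (r 0) # answers G (\<tau> (answer G B (r 0))) (\<lambda>i. r (Suc i)) t" for r t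
    by (subst answers_Suc_shift) (simp add: \<sigma>_def)
  have "winning_strategy_from G \<sigma> S"
    unfolding winning_strategy_from_def
  proof (intro allI impI, elim conjE)
    fix r assume r: "robber_walk G r" "r 0 \<in> S"
    consider "\<forall>v\<in>S. answer G B v = answer G B (r 0) \<longrightarrow> v = r 0"
      | "winning_strategy_from G (\<tau> (answer G B (r 0))) (closed_nbhd G (?C (r 0)))"
      using \<tau>[of "answer G B (r 0)"] r(2) by blast
    then show "\<exists>t. \<forall>r'. robber_walk G r' \<and> r' 0 \<in> S \<and>
        answers G \<sigma> r' (Suc t) = answers G \<sigma> r (Suc t) \<longrightarrow> r' t = r t"
    proof cases
      case 1
      then have "\<forall>r'. robber_walk G r' \<and> r' 0 \<in> S \<and>
        answers G \<sigma> r' (Suc 0) = answers G \<sigma> r (Suc 0) \<longrightarrow> r' 0 = r 0"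
        by (simp only: shift) simp
      then show ?thesis by blast
    next
      case 2
      moreover have "r (Suc 0) \<in> closed_nbhd G (?C (r 0))"
        using r by (intro robber_walk_nbhd) auto
      ultimately obtain t where t: "\<And>r'. robber_walk G r' \<Longrightarrow> r' 0 \<in> closed_nbhd G (?C (r 0)) \<Longrightarrow>
          answers G (\<tau> (answer G B (r 0))) r' (Suc t) =
          answers G (\<tau> (answer G B (r 0))) (\<lambda>i. r (Suc i)) (Suc t) \<Longrightarrow> r' t = r (Suc t)"
        using robber_walk_Suc[OF r(1)] unfolding winning_strategy_from_def by blast
      \<comment> \<open>Locating the Robber at turn \<open>t\<close> of the remaining play means
        locating him at turn \<open>Suc t\<close> of the whole play.\<close>
      have "r' (Suc t) = r (Suc t)" if "robber_walk G r'" "r' 0 \<in> S"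
        "answers G \<sigma> r' (Suc (Suc t)) = answers G \<sigma> r (Suc (Suc t))" for r'
      proof (rule t[of "\<lambda>i. r' (Suc i)"])
        show "robber_walk G (\<lambda>i. r' (Suc i))" using that(1) by (rule robber_walk_Suc)
        have eq: "answer G B (r' 0) = answer G B (r 0)"
          using that(3) unfolding shift by (rule list.inject[THEN iffD1, THEN conjunct1])
        then show "r' (Suc 0) \<in> closed_nbhd G (?C (r 0))"
          using that by (intro robber_walk_nbhd) auto
        show "answers G (\<tau> (answer G B (r 0))) (\<lambda>i. r' (Suc i)) (Suc t) =
          answers G (\<tau> (answer G B (r 0))) (\<lambda>i. r (Suc i)) (Suc t)"
          using that(3) unfolding shift[of _ "Suc t"] eq
          by (rule list.inject[THEN iffD1, THEN conjunct2])
      qed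
      then show ?thesis by blast
    qed
  qed
  with valid show ?case by blast
qed

lemma cops_winI:
  assumes "cop_wins_from G k (pverts G)"
  shows "cops_win G k"
proof -
  obtain \<sigma> where "valid_cop_strategy G k \<sigma>" and
    \<sigma>: "winning_strategy_from G \<sigma> (pverts G)"
    using cop_wins_from_strategy[OF assms] by blast
  moreover have "\<exists>t. located G \<sigma> r t" if "robber_walk G r" for r
  proof -
    have *: "q 0 \<in> pverts G" if "robber_walk G q" for q
      using that by (simp add: robber_walk_def)
    from \<sigma>[unfolded winning_strategy_from_def, rule_format, of r] * that
    obtain t where "\<forall>r'. robber_walk G r' \<and> r' 0 \<in> pverts G \<and>
        answers G \<sigma> r' (Suc t) = answers G \<sigma> r (Suc t) \<longrightarrow> r' t = r t" by blast
    then have "located G \<sigma> r t" using * unfolding located_def by blast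
    then show ?thesis ..
  qed
  ultimately show ?thesis unfolding cops_win_def by blast
qed

section \<open>Koenig's lemma and evasion\<close>

text \<open>Predecessors give paths of every finite length from every level. As levels are finite,
  some vertex starts paths to all depths; it has a successor of the same kind, and dependent choice
  builds the infinite path.\<close>

lemma koenig_finite_levels:
  fixes L :: "nat \<Rightarrow> 'a set"
  assumes fin: "\<And>t. finite (L t)" and ne: "\<And>t. L t \<noteq> {}"
    and pred: "\<And>t v. v \<in> L (Suc t) \<Longrightarrow> \<exists>u\<in>L t. R u v"
  shows "\<exists>r. \<forall>t. r t \<in> L t \<and> R (r t) (r (Suc t))"
proof -
  define reach where "reach t T u \<longleftrightarrow>
    (\<exists>q. q t = u \<and> (\<forall>s. t \<le> s \<and> s \<le> T \<longrightarrow> q s \<in> L s) \<and> (\<forall>s. t \<le> s \<and> s < T \<longrightarrow> R (q s) (q (Suc s))))"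
    for t T u
  have back_path: "\<exists>u\<in>L t. reach t (t + d) u" for t d
  proof (induction d arbitrary: t)
    case 0
    obtain u where "u \<in> L t" using ne by blast
    then show ?case by (auto simp: reach_def intro!: bexI[of _ u] exI[of _ "\<lambda>_. u"])
  next
    case (Suc d)
    obtain v q where v: "v \<in> L (Suc t)" "q (Suc t) = v"
      and q: "\<And>s. Suc t \<le> s \<Longrightarrow> s \<le> Suc t + d \<Longrightarrow> q s \<in> L s"
        "\<And>s. Suc t \<le> s \<Longrightarrow> s < Suc t + d \<Longrightarrow> R (q s) (q (Suc s))"
      using Suc[of "Suc t"] unfolding reach_def by blast
    obtain u where u: "u \<in> L t" "R u v" using pred v by blast
    have "reach t (t + Suc d) u"
      unfolding reach_def
    proof (intro exI[of _ "q(t := u)"] conjI allI impI)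
      show "(q(t := u)) s \<in> L s" if "t \<le> s \<and> s \<le> t + Suc d" for s
        using u(1) q(1)[of s] that by (cases "s = t") auto
      show "R ((q(t := u)) s) ((q(t := u)) (Suc s))" if "t \<le> s \<and> s < t + Suc d" for s
        using u(2) v(2) q(2)[of s] that by (cases "s = t") auto
    qed simp
    then show ?case using u by blast
  qed
  have reach_le: "reach t T u" if "reach t T' u" "T \<le> T'" for t T T' u
  proof -
    from that(1) obtain q where "q t = u" "\<And>s. t \<le> s \<Longrightarrow> s \<le> T' \<Longrightarrow> q s \<in> L s"
      "\<And>s. t \<le> s \<Longrightarrow> s < T' \<Longrightarrow> R (q s) (q (Suc s))"
      unfolding reach_def by blast
    then show ?thesis using that(2) unfolding reach_def by (intro exI[of _ q]) auto
  qed
  define alive where "alive t u \<longleftrightarrow> u \<in> L t \<and> (\<forall>T\<ge>t. reach t T u)" for t u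
  have pick: "\<exists>u\<in>A. \<forall>T\<ge>t. reach t T u" if "A \<subseteq> L t" "\<And>T. T \<ge> t \<Longrightarrow> \<exists>u\<in>A. reach t T u" for t A
  proof (rule ccontr)
    assume "\<not> ?thesis"
    then obtain K where K: "\<And>u. u \<in> A \<Longrightarrow> K u \<ge> t \<and> \<not> reach t (K u) u" by metis
    have fA: "finite A" using that(1) fin finite_subset by blast
    \<comment> \<open>If each \<open>u\<close> failed at some depth \<open>K u\<close>, then
      \<open>t + sum K A\<close> would be at least as deep as all of these, yet some vertex of
      \<open>A\<close> reaches it.\<close>
    from that(2)[of "t + sum K A"] obtain u where u: "u \<in> A" "reach t (t + sum K A) u" by auto
    have "K u \<le> sum K A" using u(1) fA by (simp add: member_le_sum)
    then show False using K[OF u(1)] reach_le[OF u(2), of "K u"] by auto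
  qed
  have start: "\<exists>u. alive 0 u"
    using pick[of "L 0" 0] back_path[of 0] unfolding alive_def by auto
  have step: "\<exists>v. alive (Suc t) v \<and> R u v" if "alive t u" for t u
  proof -
    \<comment> \<open>A path from \<open>u\<close> to level \<open>T\<close> passes through a
      successor of \<open>u\<close> that reaches \<open>T\<close>; so \<open>pick\<close> applies to
      the successors alone.\<close>
    have "\<exists>v\<in>{v \<in> L (Suc t). R u v}. reach (Suc t) T v" if "T \<ge> Suc t" for T
    proof -
      have "reach t T u" using \<open>alive t u\<close> that by (simp add: alive_def)
      then obtain q where q: "q t = u" "\<And>s. t \<le> s \<Longrightarrow> s \<le> T \<Longrightarrow> q s \<in> L s"
        "\<And>s. t \<le> s \<Longrightarrow> s < T \<Longrightarrow> R (q s) (q (Suc s))" unfolding reach_def by blast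
      show ?thesis
        using q that by (intro bexI[of _ "q (Suc t)"]) (auto simp: reach_def intro!: exI[of _ q])
    qed
    then show ?thesis
      using pick[of "{v \<in> L (Suc t). R u v}" "Suc t"] unfolding alive_def by auto
  qed
  obtain r where "\<And>t. alive t (r t)" "\<And>t. R (r t) (r (Suc t))"
    using dependent_nat_choice[of alive "\<lambda>_. R", OF start step] by blast
  then show ?thesis by (auto simp: alive_def)
qed

text \<open>A pair of confused positions only yields a tree of consistent walks; Koenig's lemma extracts
  a single walk that is never located.\<close>
lemma not_cops_winI:
  assumes F: "S0 \<in> F" "\<And>S. S \<in> F \<Longrightarrow> S \<subseteq> pverts G"
    and evade: "\<And>S B. S \<in> F \<Longrightarrow> valid_probe G k B \<Longrightarrow>
      \<exists>u\<in>S. \<exists>v\<in>S. u \<noteq> v \<and> answer G B u = answer G B v \<and> (\<exists>S'\<in>F. S' \<subseteq> closed_nbhd G {u, v})"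
  shows "\<not> cops_win G k"
proof
  assume "cops_win G k"
  then obtain \<sigma> where \<sigma>: "valid_cop_strategy G k \<sigma>"
    and win: "\<And>r. robber_walk G r \<Longrightarrow> \<exists>t. located G \<sigma> r t" unfolding cops_win_def by blast
  have valid: "valid_probe G k (\<sigma> h)" for h
    using \<sigma> by (simp add: valid_cop_strategy_def valid_probe_def)
  \<comment> \<open>A state is the history before a probe together with two positions which that
    probe confuses; the clause for \<open>t = 0\<close> makes the history start empty.\<close>
  define P where "P t = (\<lambda>(h, u, v). u \<noteq> v \<and> {u, v} \<subseteq> pverts G \<and>
    answer G (\<sigma> h) u = answer G (\<sigma> h) v \<and> (\<exists>S'\<in>F. S' \<subseteq> closed_nbhd G {u, v}) \<and>
    (t = 0 \<longrightarrow> h = []))" for t :: nat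
  define Q where "Q = (\<lambda>(h, u, v) (h', u', v'). h' = h @ [answer G (\<sigma> h) u] \<and>
    {u', v'} \<subseteq> closed_nbhd G {u, v})"
  have start: "\<exists>x. P 0 x"
  proof -
    from evade[OF F(1) valid[of "[]"]] obtain u v where uv: "u \<in> S0" "v \<in> S0" "u \<noteq> v"
      "answer G (\<sigma> []) u = answer G (\<sigma> []) v" "\<exists>S'\<in>F. S' \<subseteq> closed_nbhd G {u, v}" by blast
    then have "P 0 ([], u, v)" using F(2)[OF F(1)] by (auto simp: P_def)
    then show ?thesis by blast
  qed
  have step: "\<exists>y. P (Suc t) y \<and> Q x y" if "P t x" for x t
  proof -
    obtain h u v where x: "x = (h, u, v)" by (cases x)
    from that obtain S' where S': "S' \<in> F" "S' \<subseteq> closed_nbhd G {u, v}"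
      unfolding P_def x by blast
    let ?h = "h @ [answer G (\<sigma> h) u]"
    from evade[OF S'(1) valid[of ?h]] obtain u' v' where uv: "u' \<in> S'" "v' \<in> S'" "u' \<noteq> v'"
      "answer G (\<sigma> ?h) u' = answer G (\<sigma> ?h) v'" "\<exists>S'\<in>F. S' \<subseteq> closed_nbhd G {u', v'}" by blast
    have "P (Suc t) (?h, u', v')" using uv F(2)[OF S'(1)] by (auto simp: P_def)
    moreover have "Q x (?h, u', v')" using uv S'(2) by (auto simp: Q_def x)
    ultimately show ?thesis by blast
  qed
  obtain x where x: "\<And>t. P t (x t)" "\<And>t. Q (x t) (x (Suc t))"
    using dependent_nat_choice[of P "\<lambda>_. Q", OF start step] by blast
  define h where "h t = fst (x t)" for t
  define L where "L t = {fst (snd (x t)), snd (snd (x t))}" for t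
  define move where "move u v \<longleftrightarrow> v = u \<or> (u, v) \<in> parcs G" for u v
  have L_verts: "L t \<subseteq> pverts G" for t using x(1)[of t] by (auto simp: P_def L_def split: prod.splits)
  have same: "answer G (\<sigma> (h t)) u = answer G (\<sigma> (h t)) (fst (snd (x t)))" if "u \<in> L t" for t u
    using x(1)[of t] that by (auto simp: P_def L_def h_def split: prod.splits)
  have pred: "\<exists>u\<in>L t. move u v" if "v \<in> L (Suc t)" for t v
    using x(2)[of t] that by (auto simp: Q_def L_def closed_nbhd_def move_def split: prod.splits)
  obtain r where r: "\<And>t. r t \<in> L t" "\<And>t. move (r t) (r (Suc t))"
    using koenig_finite_levels[of L move] pred by (auto simp: L_def)
  have walk: "robber_walk G r"
    using r L_verts by (fastforce simp: robber_walk_def move_def)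
  \<comment> \<open>Both members of a level give the same answer, so all walks through the levels
    produce one and the same history.\<close>
  have hist: "answers G \<sigma> q T = h T" if "\<And>t. t < T \<Longrightarrow> q t \<in> L t" for q T
    using that
  proof (induction T)
    case 0
    then show ?case using x(1)[of 0] by (auto simp: P_def h_def)
  next
    case (Suc T)
    then have "answers G \<sigma> q T = h T" "q T \<in> L T" by auto
    then show ?case unfolding answers_Suc using same[of "q T" T] x(2)[of T]
      by (auto simp: Q_def h_def split: prod.splits)
  qed
  \<comment> \<open>Each member of a level is the end of a consistent walk; the member different
    from \<open>r t\<close> will refute that \<open>r\<close> is located at turn
    \<open>t\<close>.\<close>
  have reach: "\<exists>q. q t = v \<and> robber_walk G q \<and> (\<forall>s\<le>t. q s \<in> L s)" if "v \<in> L t" for t v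
  proof -
    have "\<exists>q. (\<forall>s\<ge>t. q s = v) \<and> robber_walk G q \<and> (\<forall>s\<le>t. q s \<in> L s)"
      using that
    proof (induction t arbitrary: v)
      case 0
      then show ?case using L_verts[of 0] by (intro exI[of _ "\<lambda>_. v"]) (auto simp: robber_walk_def)
    next
      case (Suc t)
      obtain u where u: "u \<in> L t" "move u v" using pred Suc.prems by blast
      then obtain q where q: "\<And>s. s \<ge> t \<Longrightarrow> q s = u" "robber_walk G q" "\<And>s. s \<le> t \<Longrightarrow> q s \<in> L s"
        using Suc.IH by blast
      define q' where "q' s = (if s \<le> t then q s else v)" for s
      have "v \<in> pverts G" using Suc.prems L_verts by blast
      then have "q' s \<in> pverts G" for s
        using q(2) by (simp add: q'_def robber_walk_def)
      moreover have "q' (Suc s) = q' s \<or> (q' s, q' (Suc s)) \<in> parcs G" for s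
      proof -
        consider "s < t" | "s = t" | "s > t" by linarith
        then show ?thesis
        proof cases
          case 1
          then show ?thesis using q(2) by (simp add: q'_def robber_walk_def)
        next
          case 2
          then show ?thesis using q(1)[of t] u(2) by (simp add: q'_def move_def)
        next
          case 3
          then show ?thesis by (simp add: q'_def)
        qed
      qed
      ultimately have "robber_walk G q'" by (simp add: robber_walk_def)
      moreover have "\<forall>s\<ge>Suc t. q' s = v" "\<forall>s\<le>Suc t. q' s \<in> L s"
        using q(3) Suc.prems by (auto simp: q'_def le_Suc_eq)
      ultimately show ?case by blast
    qed
    then show ?thesis by blast
  qed
  obtain t where t: "located G \<sigma> r t" using win walk by blast
  obtain v where v: "v \<in> L t" "v \<noteq> r t"
    using x(1)[of t] by (auto simp: P_def L_def split: prod.splits)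
  obtain q where q: "q t = v" "robber_walk G q" "\<And>s. s \<le> t \<Longrightarrow> q s \<in> L s" using reach v(1) by blast
  have "answers G \<sigma> q (Suc t) = answers G \<sigma> r (Suc t)"
    using hist[of "Suc t" q] hist[of "Suc t" r] q r by simp
  then show False using t q v unfolding located_def by blast
qed

section \<open>Distance on a cycle\<close>

text \<open>The distance between \<open>z\<close> and 0 on a cycle of length \<open>m\<close>,
  defined on all integers so that no representatives have to be chosen.\<close>

definition cyc_dist :: "int \<Rightarrow> int \<Rightarrow> int" where
  "cyc_dist m z = min (z mod m) ((- z) mod m)"

lemma cyc_dist_cong: "[z = w] (mod m) \<Longrightarrow> cyc_dist m z = cyc_dist m w"
  unfolding cyc_dist_def cong_def by (metis mod_minus_cong)

lemma cyc_dist_minus: "cyc_dist m (- z) = cyc_dist m z"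
  by (simp add: cyc_dist_def min.commute)

lemma cyc_dist_nonneg: "m > 0 \<Longrightarrow> cyc_dist m z \<ge> 0"
  by (simp add: cyc_dist_def)

text \<open>This form without \<open>mod\<close> turns later distance computations into linear
  arithmetic.\<close>

lemma cyc_dist_eq:
  assumes "m > 0" "\<bar>z\<bar> \<le> m"
  shows "cyc_dist m z = min \<bar>z\<bar> (m - \<bar>z\<bar>)"
proof -
  have *: "cyc_dist m z = min z (m - z)" if "0 \<le> z" "z \<le> m" for z
  proof -
    from that consider "z = 0" | "z = m" | "0 < z" "z < m" by linarith
    then show ?thesis
    proof cases
      case 3
      then have "(- z) mod m = m - z" by (simp add: zmod_zminus1_eq_if)
      then show ?thesis using 3 by (simp add: cyc_dist_def)
    qed (use assms in \<open>auto simp: cyc_dist_def\<close>)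
  qed
  show ?thesis
  proof (cases "z \<ge> 0")
    case False
    then show ?thesis using *[of "- z"] assms by (simp add: cyc_dist_minus)
  qed (use * assms in simp)
qed

lemma cyc_dist_rep:
  assumes "(m::int) > 0"
  obtains r where "[z = r] (mod m)" "0 \<le> r" "r < m"
  by (rule that[of "z mod m"]) (use assms in \<open>simp_all add: cong_def\<close>)

lemma cong_imp_eq_int:
  fixes a b m :: int
  assumes "[a = b] (mod m)" "\<bar>a - b\<bar> < m"
  shows "a = b"
  using dvd_imp_le_int[of "a - b" m] assms by (auto simp: cong_iff_dvd_diff)

lemma not_cong_int: "\<not> [a = b] (mod m)" if "a \<noteq> b" "\<bar>a - b\<bar> < m" for a b m :: int
  using that cong_imp_eq_int by blast

text \<open>For a representative \<open>r\<close>, the value \<open>min r (m - r)\<close> determines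
  \<open>r\<close> up to the reflection \<open>m - r\<close>.\<close>

lemma cyc_dist_eq_iff:
  assumes "m > 0"
  shows "cyc_dist m z = cyc_dist m w \<longleftrightarrow> [z = w] (mod m) \<or> [z = - w] (mod m)"
proof
  assume "[z = w] (mod m) \<or> [z = - w] (mod m)"
  then show "cyc_dist m z = cyc_dist m w"
    using cyc_dist_cong cyc_dist_minus by metis
next
  assume eq: "cyc_dist m z = cyc_dist m w"
  obtain r where r: "[z = r] (mod m)" "0 \<le> r" "r < m" using cyc_dist_rep[OF assms] .
  obtain s where s: "[w = s] (mod m)" "0 \<le> s" "s < m" using cyc_dist_rep[OF assms] .
  have "min r (m - r) = min s (m - s)"
    using eq cyc_dist_eq[OF assms, of r] cyc_dist_eq[OF assms, of s] r s
      cyc_dist_cong[OF r(1)] cyc_dist_cong[OF s(1)] by simp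
  then consider "r = s" | "r = m - s" by linarith
  then show "[z = w] (mod m) \<or> [z = - w] (mod m)"
  proof cases
    case 1
    then show ?thesis using r s by (metis cong_sym cong_trans)
  next
    case 2
    have "[m - s = 0 - w] (mod m)" using s(1) by (intro cong_diff) (simp_all add: cong_def)
    then show ?thesis using r 2 cong_trans by auto
  qed
qed

lemma cyc_dist_eq_0_iff:
  assumes "m > 0"
  shows "cyc_dist m z = 0 \<longleftrightarrow> [z = 0] (mod m)"
  using cyc_dist_eq_iff[OF assms, of z 0] by (simp add: cyc_dist_def)

text \<open>Together with \<open>cyc_dist_descent\<close>, this supplies in each coordinate what
  \<open>graph_dist_eqI\<close> requires.\<close>

lemma cyc_dist_step:
  assumes "m > 1"
  shows "\<bar>cyc_dist m (z + 1) - cyc_dist m z\<bar> \<le> 1"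
proof -
  obtain r where r: "[z = r] (mod m)" "0 \<le> r" "r < m" using cyc_dist_rep[of m] assms by auto
  have "[z + 1 = r + 1] (mod m)" using r(1) by (simp add: cong_add)
  then show ?thesis
    using cyc_dist_cong[OF r(1)] cyc_dist_cong[of "z + 1"] cyc_dist_eq[of m r] cyc_dist_eq[of m "r + 1"]
      assms r by simp
qed

lemma cyc_dist_descent:
  assumes "m > 1" "cyc_dist m z \<noteq> 0"
  shows "cyc_dist m (z + 1) < cyc_dist m z \<or> cyc_dist m (z - 1) < cyc_dist m z"
proof -
  obtain r where r: "[z = r] (mod m)" "0 \<le> r" "r < m" using cyc_dist_rep[of m] assms by auto
  have "[z + 1 = r + 1] (mod m)" "[z - 1 = r - 1] (mod m)"
    using r(1) by (auto intro: cong_add cong_diff)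
  then have "cyc_dist m z = min r (m - r)" "cyc_dist m (z + 1) = min (r + 1) (m - (r + 1))"
    "cyc_dist m (z - 1) = min \<bar>r - 1\<bar> (m - \<bar>r - 1\<bar>)"
    using cyc_dist_cong r cyc_dist_eq[of m] assms by simp_all
  then show ?thesis using r assms(2) by linarith
qed

text \<open>On an even cycle the two arcs, of lengths \<open>r\<close> and \<open>m - r\<close>,
  have the same parity.\<close>

lemma even_cyc_dist:
  assumes "even m" "m > 0"
  shows "even (cyc_dist m z) \<longleftrightarrow> even z"
proof -
  obtain r where r: "[z = r] (mod m)" "0 \<le> r" "r < m" using cyc_dist_rep[of m] assms by auto
  have "even z \<longleftrightarrow> even r" using r(1) assms(1) by (metis cong_dvd_iff cong_dvd_modulus)
  moreover have "cyc_dist m z = min r (m - r)"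
    using cyc_dist_cong[OF r(1)] cyc_dist_eq[of m r] r assms by simp
  ultimately show ?thesis using assms by (auto simp: min_def)
qed

section \<open>The torus covered by the integer plane\<close>

definition unit_moves :: "(int \<times> int) set" where
  "unit_moves = {(0, 0), (1, 0), (-1, 0), (0, 1), (0, -1)}"

text \<open>The type of vertices stays open and \<open>M\<close> and \<open>N\<close> are not
  ordered, so exchanging the coordinates gives another instance (\<open>swap\<close>).\<close>

locale torus =
  fixes G :: "'a pair_pre_digraph" and pos :: "int \<Rightarrow> int \<Rightarrow> 'a" and M N :: int
  assumes M3: "M \<ge> 3" and N3: "N \<ge> 3"
    and graph: "pair_graph G"
    and verts: "v \<in> pverts G \<longleftrightarrow> (\<exists>x y. v = pos x y)"
    and pos_eq_iff: "pos x y = pos x' y' \<longleftrightarrow> [x = x'] (mod M) \<and> [y = y'] (mod N)"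
    and arcs: "(pos x y, v) \<in> parcs G \<longleftrightarrow>
      v \<in> {pos (x + 1) y, pos (x - 1) y, pos x (y + 1), pos x (y - 1)}"
begin

lemma swap: "torus G (\<lambda>x y. pos y x) N M"
proof (rule torus.intro)
  show "v \<in> pverts G \<longleftrightarrow> (\<exists>x y. v = pos y x)" for v using verts by blast
  show "pos y x = pos y' x' \<longleftrightarrow> [x = x'] (mod N) \<and> [y = y'] (mod M)" for x y x' y'
    using pos_eq_iff by blast
  show "(pos y x, v) \<in> parcs G \<longleftrightarrow> v \<in> {pos y (x + 1), pos y (x - 1), pos (y + 1) x, pos (y - 1) x}" for x y v
    using arcs by blast
qed (use M3 N3 graph in auto)

lemma pos_in_verts [simp]: "pos x y \<in> pverts G"
  using verts by blast

lemma posE: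
  assumes "v \<in> pverts G"
  obtains x y where "v = pos x y"
  using assms verts by blast

lemma graph_dist_pos:
  "graph_dist G (pos x y) (pos a c) = ereal (real_of_int (cyc_dist M (x - a) + cyc_dist N (y - c)))"
proof -
  \<comment> \<open>\<open>X\<close> and \<open>Y\<close> choose a lift of each vertex; the
    potential \<open>f\<close> does not depend on this choice, as the next fact shows.\<close>
  obtain X Y where XY: "\<And>v. v \<in> pverts G \<Longrightarrow> pos (X v) (Y v) = v" using verts by metis
  define f where "f v = nat (cyc_dist M (X v - a) + cyc_dist N (Y v - c))" for v
  have f: "f (pos x y) = nat (cyc_dist M (x - a) + cyc_dist N (y - c))" for x y
  proof -
    have "[X (pos x y) = x] (mod M)" "[Y (pos x y) = y] (mod N)"
      using XY[of "pos x y"] by (simp_all add: pos_eq_iff)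
    then have "cyc_dist M (X (pos x y) - a) = cyc_dist M (x - a)"
      "cyc_dist N (Y (pos x y) - c) = cyc_dist N (y - c)"
      by (auto intro!: cyc_dist_cong cong_diff)
    then show ?thesis by (simp add: f_def)
  qed
  have nn: "cyc_dist M z \<ge> 0" "cyc_dist N z \<ge> 0" for z
    using cyc_dist_nonneg M3 N3 by auto
  have "graph_dist G (pos x y) (pos a c) = ereal (real (f (pos x y)))"
  proof (rule graph_dist_eqI[OF graph])
    show "f (pos a c) = 0" using M3 N3 by (simp add: f cyc_dist_eq)
  next
    fix v w assume vw: "(v, w) \<in> parcs G"
    then have "v \<in> pverts G"
      using graph pair_wf_digraph.wellformed'[of G] by (meson pair_graph.axioms pair_fin_digraph.axioms
          pair_pseudo_graph.axioms pair_sym_digraph.axioms)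
    then obtain x y where v: "v = pos x y" by (rule posE)
    have "\<bar>cyc_dist M (x + 1 - a) - cyc_dist M (x - a)\<bar> \<le> 1"
      "\<bar>cyc_dist M (x - a) - cyc_dist M (x - 1 - a)\<bar> \<le> 1"
      "\<bar>cyc_dist N (y + 1 - c) - cyc_dist N (y - c)\<bar> \<le> 1"
      "\<bar>cyc_dist N (y - c) - cyc_dist N (y - 1 - c)\<bar> \<le> 1"
      using cyc_dist_step[of M "x - a"] cyc_dist_step[of M "x - 1 - a"]
        cyc_dist_step[of N "y - c"] cyc_dist_step[of N "y - 1 - c"] M3 N3
      by (simp_all add: algebra_simps)
    moreover have "w \<in> {pos (x + 1) y, pos (x - 1) y, pos x (y + 1), pos x (y - 1)}"
      using vw by (simp add: v arcs)
    ultimately show "f v \<le> Suc (f w)"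
      using nn[of "x - a"] nn[of "y - c"] by (auto simp: v f)
  next
    fix v assume "v \<in> pverts G" "v \<noteq> pos a c"
    then obtain x y where v: "v = pos x y" using posE by blast
    then have "\<not> ([x = a] (mod M) \<and> [y = c] (mod N))" using \<open>v \<noteq> pos a c\<close> by (simp add: pos_eq_iff)
    then have "cyc_dist M (x - a) \<noteq> 0 \<or> cyc_dist N (y - c) \<noteq> 0"
      using M3 N3 by (simp add: cyc_dist_eq_0_iff cong_diff_iff_cong_0)
    then consider "cyc_dist M (x + 1 - a) < cyc_dist M (x - a)" | "cyc_dist M (x - 1 - a) < cyc_dist M (x - a)"
      | "cyc_dist N (y + 1 - c) < cyc_dist N (y - c)" | "cyc_dist N (y - 1 - c) < cyc_dist N (y - c)"
      using cyc_dist_descent[of M "x - a"] cyc_dist_descent[of N "y - c"] M3 N3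
      by (auto simp: algebra_simps)
    then show "\<exists>w. (v, w) \<in> parcs G \<and> f w < f v"
    proof cases
      case 1
      then show ?thesis using nn[of "x + 1 - a"] nn[of "y - c"]
        by (intro exI[of _ "pos (x + 1) y"]) (simp add: v f arcs)
    next
      case 2
      then show ?thesis using nn[of "x - 1 - a"] nn[of "y - c"]
        by (intro exI[of _ "pos (x - 1) y"]) (simp add: v f arcs)
    next
      case 3
      then show ?thesis using nn[of "x - a"] nn[of "y + 1 - c"]
        by (intro exI[of _ "pos x (y + 1)"]) (simp add: v f arcs)
    next
      case 4
      then show ?thesis using nn[of "x - a"] nn[of "y - 1 - c"]
        by (intro exI[of _ "pos x (y - 1)"]) (simp add: v f arcs)
    qed
  qed simp
  then show ?thesis using nn[of "x - a"] nn[of "y - c"] by (simp add: f)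
qed

lemma answer_pos_eq_iff:
  "answer G (map (\<lambda>(a, c). pos a c) B) (pos x y) = answer G (map (\<lambda>(a, c). pos a c) B) (pos x' y') \<longleftrightarrow>
    (\<forall>(a, c)\<in>set B. cyc_dist M (x - a) + cyc_dist N (y - c) = cyc_dist M (x' - a) + cyc_dist N (y' - c))"
  by (auto simp: answer_def graph_dist_pos simp flip: of_int_add)

end

lemma torus_cycle_graphs:
  assumes "m \<ge> 3" "n \<ge> 3"
  shows "torus (cycle_graph m \<box> cycle_graph n)
    (\<lambda>x y. (nat (x mod int m), nat (y mod int n))) (int m) (int n)"
proof -
  have cyc: "(nat (x mod int k), v) \<in> parcs (cycle_graph k) \<longleftrightarrow>
      v = nat ((x + 1) mod int k) \<or> v = nat ((x - 1) mod int k)" if "k \<ge> 3" for x k v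
  proof -
    define i where "i = nat (x mod int k)"
    have i: "i < k" "int i = x mod int k" using that by (simp_all add: i_def nat_less_iff)
    have 1: "nat ((x + 1) mod int k) = Suc i mod k"
      using i(2) by (metis mod_add_left_eq nat_int of_nat_Suc add.commute zmod_int)
    have 2: "nat ((x - 1) mod int k) = (if i = 0 then k - 1 else i - 1)"
    proof -
      have "(x - 1) mod int k = (int i - 1) mod int k" using i(2) by (simp add: mod_diff_left_eq)
      also have "\<dots> = (if i = 0 then int k - 1 else int i - 1)"
        using i(1) that by (auto simp: zmod_minus1)
      finally show ?thesis using that by auto
    qed
    show ?thesis
      unfolding 1 2 i_def[symmetric] using i(1) that
      by (auto simp: cycle_graph_def mod_Suc split: if_splits)
  qed
  have vert: "v < k \<longleftrightarrow> (\<exists>x. v = nat (x mod int k))" if "k \<ge> 3" for v k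
  proof
    assume "v < k"
    then have "v = nat (int v mod int k)" by simp
    then show "\<exists>x. v = nat (x mod int k)" by blast
  qed (use that in \<open>auto simp: nat_less_iff\<close>)
  have eq: "nat (x mod int k) = nat (x' mod int k) \<longleftrightarrow> [x = x'] (mod int k)" if "k \<ge> 3" for x x' k
    using that by (simp add: cong_def nat_eq_iff)
  have in_v: "nat (x mod int k) \<in> pverts (cycle_graph k)" if "k \<ge> 3" for x k
    using vert[OF that] by (auto simp: cycle_graph_def)
  show ?thesis
  proof (rule torus.intro)
    show "v \<in> pverts (cycle_graph m \<box> cycle_graph n) \<longleftrightarrow>
        (\<exists>x y. v = (nat (x mod int m), nat (y mod int n)))" for v
      using vert[OF assms(1)] vert[OF assms(2)]
      by (cases v) (simp add: cartesian_prod_def cycle_graph_def)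
    show "((nat (x mod int m), nat (y mod int n)), v) \<in> parcs (cycle_graph m \<box> cycle_graph n) \<longleftrightarrow>
      v \<in> {(nat ((x + 1) mod int m), nat (y mod int n)), (nat ((x - 1) mod int m), nat (y mod int n)),
           (nat (x mod int m), nat ((y + 1) mod int n)), (nat (x mod int m), nat ((y - 1) mod int n))}"
      for x y v
      by (cases v) (simp add: cartesian_prod_def cyc[OF assms(1)] cyc[OF assms(2)]
          in_v[OF assms(1)] in_v[OF assms(2)], blast)
  qed (use assms eq in \<open>auto intro!: pair_graph_cycle_graph pair_graph_cartesian_prod\<close>)
qed

section \<open>Arithmetic of pairs of probes\<close>

text \<open>For a representative \<open>r \<le> k\<close> the two distances are \<open>r\<close> and
  \<open>k - r\<close>, with sum \<open>k\<close>; otherwise they are \<open>m - r\<close> and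
  \<open>r - k\<close>, with sum \<open>k + 1\<close>. The common summand \<open>s\<close> enters
  the total twice, so the parity of the total reveals the half, and the difference of the answers
  then reveals \<open>r\<close>.\<close>

lemma cyc_dist_odd_pair:
  assumes "m = 2 * k + 1" "k \<ge> 1"
    and "cyc_dist m x + s = cyc_dist m x' + s'"
    and "cyc_dist m (x - k) + s = cyc_dist m (x' - k) + s'"
  shows "[x = x'] (mod m) \<and> s = s'"
proof -
  have m: "m > 0" using assms by simp
  obtain r where r: "[x = r] (mod m)" "0 \<le> r" "r < m" using cyc_dist_rep[OF m] .
  obtain r' where r': "[x' = r'] (mod m)" "0 \<le> r'" "r' < m" using cyc_dist_rep[OF m] .
  have rk: "[x - k = r - k] (mod m)" "[x' - k = r' - k] (mod m)"
    using r(1) r'(1) by (auto intro: cong_diff)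
  have "cyc_dist m x = min r (m - r)" "cyc_dist m x' = min r' (m - r')"
    "cyc_dist m (x - k) = min \<bar>r - k\<bar> (m - \<bar>r - k\<bar>)"
    "cyc_dist m (x' - k) = min \<bar>r' - k\<bar> (m - \<bar>r' - k\<bar>)"
    using cyc_dist_cong[OF r(1)] cyc_dist_cong[OF r'(1)] cyc_dist_cong[OF rk(1)] cyc_dist_cong[OF rk(2)]
      r r' assms(1,2) by (simp_all add: cyc_dist_eq)
  then have *: "min r (m - r) + s = min r' (m - r') + s'"
    "min \<bar>r - k\<bar> (m - \<bar>r - k\<bar>) + s = min \<bar>r' - k\<bar> (m - \<bar>r' - k\<bar>) + s'"
    using assms(3,4) by simp_all
  have form: "min r (m - r) = (if r \<le> k then r else m - r)"
    "min \<bar>r - k\<bar> (m - \<bar>r - k\<bar>) = (if r \<le> k then k - r else r - k)"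
    if "0 \<le> r" "r < m" for r
    using that assms(1,2) by (auto simp: min_def)
  have "r = r' \<and> s = s'"
    using *[unfolded form[OF r(2,3)] form[OF r'(2,3)]] assms(1)
    by (cases "r \<le> k"; cases "r' \<le> k") (simp_all, presburger+)
  then show ?thesis using r(1) r'(1) by (metis cong_sym cong_trans)
qed

text \<open>Every point lies on a shortest path between the antipodes 0 and
  \<open>k\<close>.\<close>

lemma cyc_dist_even_antipode:
  assumes "m = 2 * k" "k > 0"
  shows "cyc_dist m (x - k) = k - cyc_dist m x"
proof -
  have m: "m > 0" using assms by simp
  obtain r where r: "[x = r] (mod m)" "0 \<le> r" "r < m" using cyc_dist_rep[OF m] .
  have "[x - k = r - k] (mod m)" using r(1) by (auto intro: cong_diff)
  then have "cyc_dist m x = min r (m - r)" "cyc_dist m (x - k) = min \<bar>r - k\<bar> (m - \<bar>r - k\<bar>)"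
    using cyc_dist_cong[OF r(1)] cyc_dist_cong r assms by (simp_all add: cyc_dist_eq)
  then show ?thesis using r assms by (simp add: min_def)
qed

text \<open>If \<open>y\<close> and \<open>y'\<close> differed, they would be mirror images with
  respect to both 0 and 1, whence \<open>m dvd 2\<close>.\<close>

lemma cyc_dist_adjacent_pair:
  assumes "m \<ge> 3" "cyc_dist m y = cyc_dist m y'" "cyc_dist m (y - 1) = cyc_dist m (y' - 1)"
  shows "[y = y'] (mod m)"
proof (rule ccontr)
  assume ne: "\<not> ?thesis"
  have m: "m > 0" using assms(1) by simp
  have 1: "m dvd y + y'" using ne assms(2) m by (simp add: cyc_dist_eq_iff cong_iff_dvd_diff)
  have "m dvd (y - 1) + (y' - 1)"
    using ne assms(3) m by (simp add: cyc_dist_eq_iff cong_iff_dvd_diff)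
  then have "m dvd (y + y') - ((y - 1) + (y' - 1))" using 1 by (intro dvd_diff)
  then have "m dvd 2" by simp
  then show False using assms(1) zdvd_imp_le[of m 2] by simp
qed

text \<open>The arithmetic behind \<open>wins_2_odd_ordered\<close>: \<open>u\<close> is the offset
  of the old position, \<open>(e, f)\<close> the move and \<open>z\<close> the new height. For equal
  \<open>e\<close>, the first probe leaves at most a reflection about height 1, which the second one
  excludes. The alternatives with \<open>N\<close> arise when heights \<open>-1\<close> and
  \<open>3\<close> are the same vertex of a 4-cycle. For different \<open>e\<close> the claim is a
  finite check, as a horizontal move keeps the height at 0 or \<open>g\<close>.\<close>

lemma near_antipodal_probes_separate:
  fixes N h g k e e' z z' u u' f f' :: int
  assumes h: "2 * h \<le> N" "N \<le> 2 * h + 1" "g \<le> h" "h \<ge> 2" "0 \<le> g"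
    and u: "u \<in> {0, g}" "u' \<in> {0, g}" and z: "z = u + f" "z' = u' + f'"
    and ef: "e = 0 \<and> -1 \<le> f \<and> f \<le> 1 \<or> f = 0 \<and> (e = 1 \<or> e = -1)"
     "e' = 0 \<and> -1 \<le> f' \<and> f' \<le> 1 \<or> f' = 0 \<and> (e' = 1 \<or> e' = -1)"
   and eqs: "(if e' = 1 then k - 1 else k) + \<bar>z' - 1\<bar> = (if e = 1 then k - 1 else k) + \<bar>z - 1\<bar>"
    "(if e' = -1 then k - 1 else k) + (if z' = -1 then N - h - 1 else \<bar>z' - h\<bar>) =
      (if e = -1 then k - 1 else k) + (if z = -1 then N - h - 1 else \<bar>z - h\<bar>)"
  shows "e = e' \<and> (z = z' \<or> z - z' = N \<or> z' - z = N)"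
proof -
  have b: "-1 \<le> z" "z \<le> h + 1" "-1 \<le> z'" "z' \<le> h + 1" using u z ef h by auto
  have same: "z = z' \<or> z - z' = N \<or> z' - z = N" if "e = e'"
    using eqs b h that by (simp add: abs_if split: if_splits; linarith)
  moreover have "e = e'"
  proof (rule ccontr)
    assume ne: "e \<noteq> e'"
    consider "e = 0" "e' = 1" | "e = 0" "e' = -1" | "e = 1" "e' = 0" | "e = -1" "e' = 0" | "e = 1" "e' = -1" | "e = -1" "e' = 1"
      using ef ne by blast
    then show False
      by cases (use eqs b h ef u z in \<open>auto simp: abs_if split: if_splits\<close>, presburger+)
  qed
  ultimately show ?thesis by blast
qed

text \<open>Here \<open>f\<close>, \<open>f1\<close> and \<open>g\<close>, \<open>g1\<close> are the
  horizontal distances of two adjacent columns to two probes, and the quadruples are vertical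
  distances. In every case a probe gives three of the four vertices the same answer. So two probes
  single out at most two vertices, and the other two stay confused.\<close>

lemma core_collision:
  fixes a b c d a' b' c' d' f f1 g g1 :: int
  assumes "(a, b, c, d) \<in> {(1, 1, 0, 2), (2, 0, 1, 1), (1, 1, 2, 0), (0, 2, 1, 1)}"
    and "(a', b', c', d') \<in> {(1, 1, 0, 2), (2, 0, 1, 1), (1, 1, 2, 0), (0, 2, 1, 1)}"
    and "f1 = f + 1 \<or> f1 = f - 1" "g1 = g + 1 \<or> g1 = g - 1"
  shows "f + a = f + b \<and> g + a' = g + b' \<or> f1 + c = f1 + d \<and> g1 + c' = g1 + d' \<or>
    f + a = f1 + c \<and> g + a' = g1 + c' \<or> f + a = f1 + d \<and> g + a' = g1 + d' \<or>
    f + b = f1 + c \<and> g + b' = g1 + c' \<or> f + b = f1 + d \<and> g + b' = g1 + d'"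
  using assms by (elim insertE emptyE disjE) simp_all

text \<open>The counterpart of \<open>closed_nbhd\<close> on integer points, linked to it by
  \<open>closed_nbhd_vtx\<close>.\<close>

definition moves_from :: "(int \<times> int) set \<Rightarrow> (int \<times> int) set" where
  "moves_from Q = {(x + e, y + f) |x y e f. (x, y) \<in> Q \<and> (e, f) \<in> unit_moves}"

section \<open>The game in integer coordinates\<close>

context torus
begin

definition vtx :: "int \<times> int \<Rightarrow> 'a" where
  "vtx = (\<lambda>(x, y). pos x y)"

definition indist :: "(int \<times> int) list \<Rightarrow> int \<times> int \<Rightarrow> int \<times> int \<Rightarrow> bool" where
  "indist B p q \<longleftrightarrow> (\<forall>(a, c)\<in>set B. cyc_dist M (fst p - a) + cyc_dist N (snd p - c) =
    cyc_dist M (fst q - a) + cyc_dist N (snd q - c))"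

text \<open>\<open>Q\<close> holds the candidates after an answer and before the Robber moves,
  whereas \<open>cop_wins_from\<close> starts just before a probe.\<close>

definition wins :: "nat \<Rightarrow> (int \<times> int) set \<Rightarrow> bool" where
  "wins k Q \<longleftrightarrow> cop_wins_from G k (closed_nbhd G (vtx ` Q))"

lemma vtx_Pair: "vtx (x, y) = pos x y"
  by (simp add: vtx_def)

lemma answer_vtx_eq_iff: "answer G (map vtx B) (vtx p) = answer G (map vtx B) (vtx q) \<longleftrightarrow> indist B p q"
  using answer_pos_eq_iff[of B "fst p" "snd p" "fst q" "snd q"]
  by (simp add: indist_def vtx_def case_prod_beta)

lemma vtx_in_verts [simp]: "vtx p \<in> pverts G"
  by (simp add: vtx_def case_prod_beta)

lemma range_vtx: "pverts G = range vtx"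
  by (force simp: vtx_def verts image_iff)

lemma closed_nbhd_vtx: "closed_nbhd G (vtx ` Q) = vtx ` moves_from Q"
proof (intro equalityI subsetI)
  fix v assume "v \<in> closed_nbhd G (vtx ` Q)"
  then obtain x y where xy: "(x, y) \<in> Q" "v = pos x y \<or> (pos x y, v) \<in> parcs G"
    by (auto simp: closed_nbhd_def vtx_def)
  then obtain e f where ef: "(e, f) \<in> unit_moves" "v = pos (x + e) (y + f)"
    by (force simp: unit_moves_def arcs)
  then have "(x + e, y + f) \<in> moves_from Q" using xy(1) by (auto simp: moves_from_def)
  then show "v \<in> vtx ` moves_from Q" using ef(2) by (force simp: vtx_def)
next
  fix v assume "v \<in> vtx ` moves_from Q"
  then obtain x y e f where "v = pos (x + e) (y + f)" "(x, y) \<in> Q" "(e, f) \<in> unit_moves"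
    by (auto simp: moves_from_def vtx_def)
  then show "v \<in> closed_nbhd G (vtx ` Q)"
    by (force simp: closed_nbhd_def vtx_def unit_moves_def arcs)
qed

lemma cop_wins_from_vtxI:
  assumes "distinct (map vtx B)" "length B = k"
    and "\<And>p. p \<in> R \<Longrightarrow> (\<forall>q\<in>R. indist B q p \<longrightarrow> vtx q = vtx p) \<or>
      (\<exists>Q. wins k Q \<and> (\<forall>q\<in>R. indist B q p \<longrightarrow> vtx q \<in> vtx ` Q))"
  shows "cop_wins_from G k (vtx ` R)"
proof (rule cop_wins_fromI[of G k "map vtx B"])
  show "valid_probe G k (map vtx B)" using assms(1,2) by (auto simp: valid_probe_def)
  fix u assume "u \<in> vtx ` R"
  then obtain p where p: "p \<in> R" "u = vtx p" by blast
  show "(\<forall>v\<in>vtx ` R. answer G (map vtx B) v = answer G (map vtx B) u \<longrightarrow> v = u) \<or>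
      (\<exists>X. cop_wins_from G k (closed_nbhd G X) \<and>
           (\<forall>v\<in>vtx ` R. answer G (map vtx B) v = answer G (map vtx B) u \<longrightarrow> v \<in> X))"
    using assms(3)[OF p(1)] unfolding wins_def p(2) ball_simps answer_vtx_eq_iff by blast
qed

lemmas winsI = cop_wins_from_vtxI[of _ _ "moves_from Q" for Q, folded closed_nbhd_vtx, folded wins_def]

lemma cops_win_vtxI:
  assumes "distinct (map vtx B)" "length B = k"
    and "\<And>p. (\<forall>q. indist B q p \<longrightarrow> vtx q = vtx p) \<or>
      (\<exists>Q. wins k Q \<and> (\<forall>q. indist B q p \<longrightarrow> vtx q \<in> vtx ` Q))"
  shows "cops_win G k"
  using cop_wins_from_vtxI[of B k UNIV] assms by (intro cops_winI) (simp add: range_vtx)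

lemma wins_mono:
  assumes "wins k Q'" "vtx ` Q \<subseteq> vtx ` Q'"
  shows "wins k Q"
  using assms unfolding wins_def by (metis cop_wins_from_antimono closed_nbhd_mono)

subsection \<open>Two cops, one cycle odd\<close>

text \<open>The column is known up to one step. The probe \<open>k\<close> columns to the right gets
  nearer only by a step to the right, the other one only by a step to the left, and their heights
  are nearly antipodal. This tells all positions apart.\<close>

lemma wins_2_odd_ordered:
  assumes M: "M = 2 * k + 1" and N: "N \<ge> 4" and g: "0 \<le> g" "2 * g \<le> N"
  shows "wins 2 {(x, y), (x, y + g)}"
proof -
  have k: "k \<ge> 1" using M M3 by simp
  define h where "h = N div 2"
  have h: "2 * h \<le> N" "N \<le> 2 * h + 1" "g \<le> h" "h \<ge> 2" using g N unfolding h_def by presburger+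
  let ?B = "[(x + k, y + 1), (x - k, y + h)]"
  \<comment> \<open>A step away from a probe at distance \<open>k\<close> leaves the distance at
    \<open>k\<close>, because the other arc then has length \<open>k\<close>.\<close>
  have dM: "cyc_dist M (e - k) = (if e = 1 then k - 1 else k)"
    "cyc_dist M (e + k) = (if e = -1 then k - 1 else k)" if "e \<in> {-1, 0, 1}" for e
    using that M k by (auto simp: cyc_dist_eq)
  \<comment> \<open>From offset \<open>-1\<close> the shorter way to height \<open>h\<close> goes
    around the back of the cycle.\<close>
  have dN: "cyc_dist N (z - 1) = \<bar>z - 1\<bar>"
    "cyc_dist N (z - h) = (if z = -1 then N - h - 1 else \<bar>z - h\<bar>)" if "- 1 \<le> z" "z \<le> g + 1" for z
    using that h N by (auto simp: cyc_dist_eq min_def abs_if)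
  have key: "vtx q = vtx p" if p: "p \<in> moves_from {(x, y), (x, y + g)}"
    and q: "q \<in> moves_from {(x, y), (x, y + g)}" and eq: "indist ?B q p" for p q
  proof -
    obtain u e f where p': "p = (x + e, y + u + f)" "u \<in> {0, g}" "(e, f) \<in> unit_moves"
      using p by (force simp: moves_from_def)
    obtain u' e' f' where q': "q = (x + e', y + u' + f')" "u' \<in> {0, g}" "(e', f') \<in> unit_moves"
      using q by (force simp: moves_from_def)
    define z z' where "z = u + f" and "z' = u' + f'"
    have z: "-1 \<le> z" "z \<le> g + 1" "-1 \<le> z'" "z' \<le> g + 1"
      using p'(2,3) q'(2,3) g(1) by (auto simp: z_def z'_def unit_moves_def)
    have e: "e \<in> {-1, 0, 1}" "e' \<in> {-1, 0, 1}" using p'(3) q'(3) by (auto simp: unit_moves_def)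
    have "cyc_dist M (e' - k) + cyc_dist N (z' - 1) = cyc_dist M (e - k) + cyc_dist N (z - 1)"
      "cyc_dist M (e' + k) + cyc_dist N (z' - h) = cyc_dist M (e + k) + cyc_dist N (z - h)"
      using eq by (simp_all add: indist_def p'(1) q'(1) z_def z'_def algebra_simps)
    note eqs = this[unfolded dM[OF e(1)] dM[OF e(2)] dN[OF z(1,2)] dN[OF z(3,4)]]
    have moves: "e = 0 \<and> -1 \<le> f \<and> f \<le> 1 \<or> f = 0 \<and> (e = 1 \<or> e = -1)"
      "e' = 0 \<and> -1 \<le> f' \<and> f' \<le> 1 \<or> f' = 0 \<and> (e' = 1 \<or> e' = -1)"
      using p'(3) q'(3) by (auto simp: unit_moves_def)
    have "e = e' \<and> (z = z' \<or> z - z' = N \<or> z' - z = N)"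
      by (rule near_antipodal_probes_separate[OF h g(1) p'(2) q'(2) z_def z'_def moves eqs])
    then have "e = e'" "[z = z'] (mod N)" by (metis cong_iff_dvd_diff cong_sym dvd_refl cong_refl)+
    then have "[y + z' = y + z] (mod N)" by (simp add: cong_add cong_sym)
    then show ?thesis using \<open>e = e'\<close> by (simp add: p'(1) q'(1) vtx_Pair pos_eq_iff z_def z'_def add.assoc)
  qed
  show ?thesis
  proof (rule winsI[of ?B])
    have "\<not> [x + k = x - k] (mod M)" using M k by (intro not_cong_int) auto
    then show "distinct (map vtx ?B)" by (simp add: vtx_Pair pos_eq_iff)
  qed (use key in auto)
qed

text \<open>Of two points on a cycle, one follows the other within half the length; otherwise the
  pair is reversed.\<close>

lemma wins_2_odd:
  assumes M: "M = 2 * k + 1" and N: "N \<ge> 4"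
  shows "wins 2 {(x, y), (x, y')}"
proof -
  define g where "g = (y' - y) mod N"
  have g: "0 \<le> g" "g < N" using N by (simp_all add: g_def)
  have c: "[y' = y + g] (mod N)" unfolding g_def by (simp add: cong_def mod_add_right_eq)
  show ?thesis
  proof (cases "2 * g \<le> N")
    case True
    have "vtx (x, y') = vtx (x, y + g)" using c by (simp add: vtx_Pair pos_eq_iff)
    then show ?thesis by (intro wins_mono[OF wins_2_odd_ordered[OF M N g(1) True, of x y]]) simp
  next
    case False
    have "[y' + (N - g) = y + g + (N - g)] (mod N)" using c by (intro cong_add) auto
    then have "[y = y' + (N - g)] (mod N)" by (simp add: cong_def)
    then have "vtx (x, y) = vtx (x, y' + (N - g))" by (simp add: vtx_Pair pos_eq_iff)
    then show ?thesis
      using False g by (intro wins_mono[OF wins_2_odd_ordered[OF M N, of "N - g" x y']]) auto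
  qed
qed

lemma cops_win_2_odd:
  assumes "odd M" "N \<ge> 4"
  shows "cops_win G 2"
proof -
  obtain k where M: "M = 2 * k + 1" using assms(1) by (elim oddE)
  have k: "k \<ge> 1" using M M3 by simp
  show ?thesis
  proof (rule cops_win_vtxI[of "[(0, 0), (k, 0)]"])
    have "\<not> [0 = k] (mod M)" using M k by (intro not_cong_int) auto
    then show "distinct (map vtx [(0, 0), (k, 0)])" by (simp add: vtx_Pair pos_eq_iff)
    fix p :: "int \<times> int"
    obtain x y where p: "p = (x, y)" by (cases p)
    have "vtx q \<in> vtx ` {(x, y), (x, - y)}" if "indist [(0, 0), (k, 0)] q p" for q
    proof -
      obtain x' y' where q: "q = (x', y')" by (cases q)
      have "[x' = x] (mod M) \<and> cyc_dist N y' = cyc_dist N y"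
        using that by (intro cyc_dist_odd_pair[OF M k]) (simp_all add: indist_def p q)
      then show ?thesis using N3 by (auto simp: q vtx_Pair pos_eq_iff cyc_dist_eq_iff)
    qed
    then show "(\<forall>q. indist [(0, 0), (k, 0)] q p \<longrightarrow> vtx q = vtx p) \<or>
        (\<exists>Q. wins 2 Q \<and> (\<forall>q. indist [(0, 0), (k, 0)] q p \<longrightarrow> vtx q \<in> vtx ` Q))"
      using wins_2_odd[OF M assms(2), of x y "- y"] by blast
  qed simp
qed

subsection \<open>Two cops, both cycles even\<close>

text \<open>With probes antipodal in the first coordinate, the sum of the answers yields the second
  distance and their difference the first.\<close>

lemma indist_even_box:
  assumes "M = 2 * k" "indist [(a, c), (a + k, c)] q p"
  shows "cyc_dist M (fst q - a) = cyc_dist M (fst p - a)"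
    and "cyc_dist N (snd q - c) = cyc_dist N (snd p - c)"
proof -
  have k: "k > 0" using M3 assms(1) by simp
  have "cyc_dist M (z - (a + k)) = k - cyc_dist M (z - a)" for z
    using cyc_dist_even_antipode[OF assms(1) k, of "z - a"] by (simp add: algebra_simps)
  then have "cyc_dist M (fst q - a) + cyc_dist N (snd q - c) = cyc_dist M (fst p - a) + cyc_dist N (snd p - c)"
    "cyc_dist N (snd q - c) - cyc_dist M (fst q - a) = cyc_dist N (snd p - c) - cyc_dist M (fst p - a)"
    using assms(2) by (simp_all add: indist_def)
  then show "cyc_dist M (fst q - a) = cyc_dist M (fst p - a)"
    "cyc_dist N (snd q - c) = cyc_dist N (snd p - c)" by linarith+
qed

lemma distinct_even_box:
  assumes "M = 2 * k"
  shows "distinct (map vtx [(a, c), (a + k, c)])"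
proof -
  have "\<not> [a = a + k] (mod M)" using M3 assms by (intro not_cong_int) auto
  then show ?thesis by (simp add: vtx_Pair pos_eq_iff)
qed

text \<open>Seen from the corner \<open>(x + 2, y + 1)\<close>, all positions after a move have both
  offsets between \<open>-3\<close> and 0. Half a cycle has length at least 3, so the distances
  found by antipodal probes determine the offsets.\<close>

lemma wins_2_diagonal:
  assumes M: "M = 2 * k" and "M \<ge> 6" "N \<ge> 6"
  shows "wins 2 {(x + 1, y), (x, y - 1)}"
proof (rule winsI[OF distinct_even_box[OF M, of "x + 2" "y + 1"]])
  fix p assume p: "p \<in> moves_from {(x + 1, y), (x, y - 1)}"
  let ?B = "[(x + 2, y + 1), (x + 2 + k, y + 1)]"
  have inj: "z = z'" if "cyc_dist m z = cyc_dist m z'" "m \<ge> 6" "-3 \<le> z" "z \<le> 0" "-3 \<le> z'" "z' \<le> 0" for m z z'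
    using that by (simp add: cyc_dist_eq)
  have bound: "-3 \<le> fst r - (x + 2)" "fst r - (x + 2) \<le> 0" "-3 \<le> snd r - (y + 1)" "snd r - (y + 1) \<le> 0"
    if "r \<in> moves_from {(x + 1, y), (x, y - 1)}" for r
    using that by (auto simp: moves_from_def unit_moves_def)
  have "q = p" if "q \<in> moves_from {(x + 1, y), (x, y - 1)}" "indist ?B q p" for q
    using inj[OF indist_even_box(1)[OF M that(2)] assms(2) bound(1,2)[OF that(1)] bound(1,2)[OF p]]
      inj[OF indist_even_box(2)[OF M that(2)] assms(3) bound(3,4)[OF that(1)] bound(3,4)[OF p]]
    by (simp add: prod_eq_iff)
  then show "(\<forall>q\<in>moves_from {(x + 1, y), (x, y - 1)}. indist ?B q p \<longrightarrow> vtx q = vtx p) \<or>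
      (\<exists>Q. wins 2 Q \<and> (\<forall>q\<in>moves_from {(x + 1, y), (x, y - 1)}. indist ?B q p \<longrightarrow> vtx q \<in> vtx ` Q))"
    by blast
qed simp

text \<open>Of the nine positions after a move, these probes confuse only \<open>(x + 1, y)\<close>
  and \<open>(x, y - 1)\<close>, the pair treated in \<open>wins_2_diagonal\<close>.\<close>

lemma wins_2_straight:
  assumes M: "even M" "M \<ge> 6" and N: "even N" "N \<ge> 6"
  shows "wins 2 {(x, y), (x + 2, y)}"
proof -
  obtain k where k: "M = 2 * k" using M(1) by blast
  obtain l where l: "N = 2 * l" using N(1) by blast
  let ?R = "moves_from {(x, y), (x + 2, y)}"
  let ?B = "[(x, y + 1), (x + 2, y + l)]"
  have cong_class: "q = p \<or> {p, q} \<subseteq> {(x + 1, y), (x, y - 1)}" if "p \<in> ?R" "q \<in> ?R" "indist ?B q p" for p q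
  proof -
    define P where "P = ({(0, 0), (1, 0), (-1, 0), (0, 1), (0, -1), (2, 0), (3, 0), (2, 1), (2, -1)} :: (int \<times> int) set)"
    have R: "\<exists>a b. r = (x + a, y + b) \<and> (a, b) \<in> P" if "r \<in> ?R" for r
      using that by (force simp: moves_from_def unit_moves_def P_def)
    from R[OF that(1)] obtain a b where p: "p = (x + a, y + b)" "(a, b) \<in> P" by blast
    from R[OF that(2)] obtain a' b' where q: "q = (x + a', y + b')" "(a', b') \<in> P" by blast
    \<comment> \<open>No offset wraps around, as the lengths are at least 6. Height
      \<open>y + l\<close> is opposite to row \<open>y\<close>, so leaving that row either way
      shortens the distance.\<close>
    have d: "cyc_dist M a = \<bar>a\<bar>" "cyc_dist N (b - 1) = 1 - b" "cyc_dist M (a - 2) = \<bar>a - 2\<bar>"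
      "cyc_dist N (b - l) = l - \<bar>b\<bar>" if "(a, b) \<in> P" for a b
      using that M N k l by (auto simp: P_def cyc_dist_eq)
    have "cyc_dist M a' + cyc_dist N (b' - 1) = cyc_dist M a + cyc_dist N (b - 1)"
      "cyc_dist M (a' - 2) + cyc_dist N (b' - l) = cyc_dist M (a - 2) + cyc_dist N (b - l)"
      using that(3) by (simp_all add: indist_def p(1) q(1))
    then have "\<bar>a'\<bar> - b' = \<bar>a\<bar> - b" "\<bar>a' - 2\<bar> - \<bar>b'\<bar> = \<bar>a - 2\<bar> - \<bar>b\<bar>"
      using d[OF p(2)] d[OF q(2)] by simp_all
    then have "(a, b) = (a', b') \<or> {(a, b), (a', b')} \<subseteq> {(1, 0), (0, -1)}"
      using p(2) q(2) unfolding P_def by (elim insertE emptyE; simp)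
    then show ?thesis by (auto simp: p(1) q(1))
  qed
  show ?thesis
  proof (rule winsI[of ?B])
    have "\<not> [x = x + 2] (mod M)" using M by (intro not_cong_int) auto
    then show "distinct (map vtx ?B)" by (simp add: vtx_Pair pos_eq_iff)
    fix p assume p: "p \<in> ?R"
    have "wins 2 {(x + 1, y), (x, y - 1)}" using wins_2_diagonal[OF k M(2) N(2)] .
    then show "(\<forall>q\<in>?R. indist ?B q p \<longrightarrow> vtx q = vtx p) \<or>
        (\<exists>Q. wins 2 Q \<and> (\<forall>q\<in>?R. indist ?B q p \<longrightarrow> vtx q \<in> vtx ` Q))"
      using cong_class[OF p] by blast
  qed simp
qed

end

lemma torus_wins_swap:
  assumes "torus G pos M N" "torus.wins G (\<lambda>x y. pos y x) k {(y, x), (y', x')}"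
  shows "torus.wins G pos k {(x, y), (x', y')}"
proof -
  interpret torus G pos M N by fact
  interpret s: torus G "\<lambda>x y. pos y x" N M by (rule swap)
  show ?thesis using assms(2) unfolding wins_def s.wins_def by (simp add: vtx_Pair s.vtx_Pair)
qed



text \<open>The centre \<open>c\<close> is 0 if one of the offsets is 0. Otherwise both offsets are
  \<open>w\<close>, the two steps are opposite, and \<open>c = w\<close>. Either way the two mirror
  images are two steps apart.\<close>

lemma cong_reflected_moves:
  fixes w u u' e e' m :: int
  assumes "u \<in> {0, w}" "u' \<in> {0, w}" "\<bar>e\<bar> = 1" "\<bar>e'\<bar> = 1"
    and opp: "[u' + e' = - (u + e)] (mod m)" and ne: "\<not> [u' + e' = u + e] (mod m)"
  shows "\<exists>c s. \<bar>s\<bar> = 1 \<and> [u + e = c + s] (mod m) \<and> [- (u + e) = c - s] (mod m)"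
proof -
  consider "u = 0" | "u' = 0" | "u = w" "u' = w" using assms(1,2) by blast
  then show ?thesis
  proof cases
    case 1
    then show ?thesis using assms(3) by (intro exI[of _ 0] exI[of _ e]) simp
  next
    case 2
    have "[- (u + e) = e'] (mod m)" using opp 2 by (simp add: cong_sym)
    moreover from this have "[u + e = - e'] (mod m)"
      using cong_minus_minus_iff[of "- (u + e)" e' m] by (simp add: add.commute)
    ultimately show ?thesis using assms(4) by (intro exI[of _ 0] exI[of _ "- e'"]) simp
  next
    case 3
    then have "e' \<noteq> e" using ne by auto
    then have "e' = - e" using assms(3,4) by (auto simp: abs_if split: if_splits)
    then show ?thesis using opp 3 assms(3) by (intro exI[of _ w] exI[of _ e]) (simp add: cong_sym)
  qed
qed

lemma cyc_dist_eq_imp_even_iff: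
  assumes "even m" "m > 0" "cyc_dist m z = cyc_dist m z'"
  shows "even z \<longleftrightarrow> even z'"
  using even_cyc_dist[OF assms(1,2), of z] even_cyc_dist[OF assms(1,2), of z'] assms(3) by simp

text \<open>Different offsets mean that one of them is 0; then the common distance is 0 and the
  other is congruent to 0 as well.\<close>

lemma cong_offset_eq:
  fixes w u u' m :: int
  assumes "u \<in> {0, w}" "u' \<in> {0, w}" "m > 0" "cyc_dist m u' = cyc_dist m u"
  shows "[u' = u] (mod m)"
proof -
  consider "u = u'" | "u = 0" | "u' = 0" using assms(1,2) by blast
  then show ?thesis
  proof cases
    case 2
    then show ?thesis using assms(3,4) by (simp add: cyc_dist_eq_iff)
  next
    case 3
    then have "cyc_dist m u = 0" using assms(4) by (simp add: cyc_dist_def)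
    then show ?thesis using 3 assms(3) by (simp add: cyc_dist_eq_0_iff cong_sym)
  qed simp
qed

text \<open>The dichotomy for the coordinate that moved: either its distance determines it among the
  reachable values, or all values at this distance are two points at distance 2.\<close>

lemma reflected_moves_class:
  fixes w u u' e e' m :: int
  assumes "u \<in> {0, w}" "\<bar>e\<bar> = 1" "m > 0"
  shows "(\<forall>u'\<in>{0, w}. \<forall>e'. \<bar>e'\<bar> = 1 \<and> cyc_dist m (u' + e') = cyc_dist m (u + e) \<longrightarrow>
      [u' + e' = u + e] (mod m)) \<or>
    (\<exists>c. \<forall>z. cyc_dist m z = cyc_dist m (u + e) \<longrightarrow> [z = c] (mod m) \<or> [z = c + 2] (mod m))"
proof (rule disjCI)
  let ?z = "u + e"
  assume "\<not> (\<exists>c. \<forall>z. cyc_dist m z = cyc_dist m ?z \<longrightarrow> [z = c] (mod m) \<or> [z = c + 2] (mod m))"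
  then have no: "\<exists>z. cyc_dist m z = cyc_dist m ?z \<and> \<not> [z = c] (mod m) \<and> \<not> [z = c + 2] (mod m)" for c
    by blast
  show "\<forall>u'\<in>{0, w}. \<forall>e'. \<bar>e'\<bar> = 1 \<and> cyc_dist m (u' + e') = cyc_dist m ?z \<longrightarrow> [u' + e' = ?z] (mod m)"
  proof (intro ballI allI impI, rule ccontr)
    fix u' e' assume u': "u' \<in> {0, w}" "\<bar>e'\<bar> = 1 \<and> cyc_dist m (u' + e') = cyc_dist m ?z"
      and ne: "\<not> [u' + e' = ?z] (mod m)"
    then have "[u' + e' = - ?z] (mod m)" using assms(3) by (simp add: cyc_dist_eq_iff)
    then obtain c s where c: "\<bar>s\<bar> = 1" "[?z = c + s] (mod m)" "[- ?z = c - s] (mod m)"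
      using cong_reflected_moves[OF assms(1) u'(1) assms(2) _ _ ne] u'(2) by blast
    \<comment> \<open>The pair around the centre \<open>c\<close> consists of \<open>c - 1\<close>
      and \<open>c - 1 + 2\<close>.\<close>
    have "c - 1 + 2 = c + 1" by simp
    then obtain z where z: "cyc_dist m z = cyc_dist m ?z" "\<not> [z = c - 1] (mod m)" "\<not> [z = c + 1] (mod m)"
      using no[of "c - 1"] by metis
    have "[z = ?z] (mod m) \<or> [z = - ?z] (mod m)" using z(1) assms(3) by (simp add: cyc_dist_eq_iff)
    then have "[z = c + s] (mod m) \<or> [z = c - s] (mod m)" using c cong_trans by blast
    moreover have "s = 1 \<or> s = -1" using c(1) by linarith
    ultimately show False using z by auto
  qed
qed

context torus
begin

lemma wins_2_straight_swapped:
  assumes "even M" "M \<ge> 6" "even N" "N \<ge> 6"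
  shows "wins 2 {(x, y), (x, y + 2)}"
proof (rule torus_wins_swap)
  interpret s: torus G "\<lambda>x y. pos y x" N M by (rule swap)
  show "s.wins 2 {(y, x), (y + 2, x)}" using s.wins_2_straight assms by blast
qed unfold_locales

text \<open>Antipodal probes at the corner \<open>(x, y)\<close> reveal both distances. An unmoved
  coordinate is determined, and a moved one is determined or lies in a pair two steps apart. What
  remains is a straight pair in a row or column.\<close>

lemma wins_2_rectangle:
  assumes M: "even M" "M \<ge> 6" and N: "even N" "N \<ge> 6" and ab: "even a" "even b"
  shows "wins 2 {(x, y), (x + a, y), (x, y + b), (x + a, y + b)}" (is "wins 2 ?Q")
proof -
  obtain k where k: "M = 2 * k" using M(1) by blast
  let ?B = "[(x, y), (x + k, y)]"
  have rep: "\<exists>u v e f. p = (x + u + e, y + v + f) \<and> u \<in> {0, a} \<and> v \<in> {0, b} \<and> (e, f) \<in> unit_moves"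
    if p: "p \<in> moves_from ?Q" for p
  proof -
    from p obtain x' y' e f where "p = (x' + e, y' + f)" "(x', y') \<in> ?Q" "(e, f) \<in> unit_moves"
      by (auto simp: moves_from_def)
    then show ?thesis
      by (intro exI[of _ "x' - x"] exI[of _ "y' - y"] exI[of _ e] exI[of _ f]) auto
  qed
  have uncong: "[x + z = x + z'] (mod m)" if "[z = z'] (mod m)" for x z z' m :: int
    using that by (simp add: cong_add)
  have m: "M > 0" "N > 0" using M N by auto
  show ?thesis
  proof (rule winsI[OF distinct_even_box[OF k, of x y]])
    fix p assume "p \<in> moves_from ?Q"
    then obtain u v e f where p: "p = (x + u + e, y + v + f)" "u \<in> {0, a}" "v \<in> {0, b}"
      "(e, f) \<in> unit_moves" using rep by blast
    have q_rep: "\<exists>u' v' e' f'. q = (x + u' + e', y + v' + f') \<and> u' \<in> {0, a} \<and> v' \<in> {0, b} \<and>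
        (e', f') \<in> unit_moves \<and> \<bar>e'\<bar> = \<bar>e\<bar> \<and> \<bar>f'\<bar> = \<bar>f\<bar> \<and>
        cyc_dist M (u' + e') = cyc_dist M (u + e) \<and> cyc_dist N (v' + f') = cyc_dist N (v + f)"
      if q: "q \<in> moves_from ?Q" "indist ?B q p" for q
    proof -
      from rep[OF q(1)] obtain u' v' e' f' where q': "q = (x + u' + e', y + v' + f')" "u' \<in> {0, a}"
        "v' \<in> {0, b}" "(e', f') \<in> unit_moves" by blast
      have d: "cyc_dist M (u' + e') = cyc_dist M (u + e)" "cyc_dist N (v' + f') = cyc_dist N (v + f)"
        using indist_even_box[OF k q(2)] by (simp_all add: p(1) q'(1) algebra_simps)
      \<comment> \<open>All offsets are even, so the parity of each distance shows whether that
        coordinate was moved.\<close>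
      have "even (u' + e') \<longleftrightarrow> even (u + e)" "even (v' + f') \<longleftrightarrow> even (v + f)"
        using cyc_dist_eq_imp_even_iff M(1) N(1) m d by blast+
      moreover have "even u" "even u'" "even v" "even v'" using p(2,3) q'(2,3) ab by auto
      ultimately have "\<bar>e'\<bar> = \<bar>e\<bar>" "\<bar>f'\<bar> = \<bar>f\<bar>"
        using p(4) q'(4) by (auto simp: unit_moves_def)
      then show ?thesis using q' d by blast
    qed
    consider "e = 0" "f = 0" | "\<bar>e\<bar> = 1" "f = 0" | "e = 0" "\<bar>f\<bar> = 1"
      using p(4) by (auto simp: unit_moves_def)
    then show "(\<forall>q\<in>moves_from ?Q. indist ?B q p \<longrightarrow> vtx q = vtx p) \<or>
        (\<exists>Q. wins 2 Q \<and> (\<forall>q\<in>moves_from ?Q. indist ?B q p \<longrightarrow> vtx q \<in> vtx ` Q))"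
    proof cases
      case 1
      have "vtx q = vtx p" if q: "q \<in> moves_from ?Q" "indist ?B q p" for q
      proof -
        from q_rep[OF q] 1 obtain u' v' where q': "q = (x + u', y + v')" "u' \<in> {0, a}" "v' \<in> {0, b}"
          "cyc_dist M u' = cyc_dist M u" "cyc_dist N v' = cyc_dist N v" by auto
        have "[u' = u] (mod M)" "[v' = v] (mod N)"
          using cong_offset_eq p(2,3) q' m by blast+
        then show ?thesis using 1 by (simp add: p(1) q'(1) vtx_Pair pos_eq_iff uncong)
      qed
      then show ?thesis by blast
    next
      case 2
      have q2: "\<exists>u' v' e'. q = (x + (u' + e'), y + v') \<and> u' \<in> {0, a} \<and> \<bar>e'\<bar> = 1 \<and>
          cyc_dist M (u' + e') = cyc_dist M (u + e) \<and> [y + v' = y + v] (mod N)"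
        if q: "q \<in> moves_from ?Q" "indist ?B q p" for q
      proof -
        from q_rep[OF q] 2 obtain u' v' e' where q': "q = (x + u' + e', y + v')" "u' \<in> {0, a}"
          "v' \<in> {0, b}" "\<bar>e'\<bar> = 1" "cyc_dist M (u' + e') = cyc_dist M (u + e)"
          "cyc_dist N v' = cyc_dist N v" by auto
        have "[v' = v] (mod N)" using cong_offset_eq p(3) q'(3,6) m by blast
        then show ?thesis using q' uncong by (auto simp: add.assoc)
      qed
      from reflected_moves_class[OF p(2) 2(1) m(1)] show ?thesis
      proof
        assume *: "\<forall>u'\<in>{0, a}. \<forall>e'. \<bar>e'\<bar> = 1 \<and> cyc_dist M (u' + e') = cyc_dist M (u + e) \<longrightarrow>
          [u' + e' = u + e] (mod M)"
        have "vtx q = vtx p" if q: "q \<in> moves_from ?Q" "indist ?B q p" for q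
        proof -
          from q2[OF q] obtain u' v' e' where q': "q = (x + (u' + e'), y + v')" "u' \<in> {0, a}"
            "\<bar>e'\<bar> = 1" "cyc_dist M (u' + e') = cyc_dist M (u + e)" "[y + v' = y + v] (mod N)" by blast
          then have "[x + (u' + e') = x + (u + e)] (mod M)" using * uncong by blast
          then show ?thesis using q'(5) 2 by (simp add: p(1) q'(1) vtx_Pair pos_eq_iff add.assoc)
        qed
        then show ?thesis by blast
      next
        assume "\<exists>c. \<forall>z. cyc_dist M z = cyc_dist M (u + e) \<longrightarrow> [z = c] (mod M) \<or> [z = c + 2] (mod M)"
        then obtain c where c: "\<And>z. cyc_dist M z = cyc_dist M (u + e) \<Longrightarrow>
          [z = c] (mod M) \<or> [z = c + 2] (mod M)" by blast
        have "vtx q \<in> vtx ` {(x + c, y + v), (x + c + 2, y + v)}"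
          if q: "q \<in> moves_from ?Q" "indist ?B q p" for q
        proof -
          from q2[OF q] obtain u' v' e' where q': "q = (x + (u' + e'), y + v')"
            "cyc_dist M (u' + e') = cyc_dist M (u + e)" "[y + v' = y + v] (mod N)" by blast
          have "[x + (u' + e') = x + c] (mod M) \<or> [x + (u' + e') = x + (c + 2)] (mod M)"
            using c[OF q'(2)] uncong by blast
          then show ?thesis using q'(3) by (auto simp: q'(1) vtx_Pair pos_eq_iff add.assoc)
        qed
        then show ?thesis using wins_2_straight[OF M N, of "x + c" "y + v"] by blast
      qed
    next
      case 3
      have q3: "\<exists>u' v' f'. q = (x + u', y + (v' + f')) \<and> v' \<in> {0, b} \<and> \<bar>f'\<bar> = 1 \<and>
          cyc_dist N (v' + f') = cyc_dist N (v + f) \<and> [x + u' = x + u] (mod M)"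
        if q: "q \<in> moves_from ?Q" "indist ?B q p" for q
      proof -
        from q_rep[OF q] 3 obtain u' v' f' where q': "q = (x + u', y + v' + f')" "u' \<in> {0, a}"
          "v' \<in> {0, b}" "\<bar>f'\<bar> = 1" "cyc_dist M u' = cyc_dist M u"
          "cyc_dist N (v' + f') = cyc_dist N (v + f)" by auto
        have "[u' = u] (mod M)" using cong_offset_eq p(2) q'(2,5) m by blast
        then show ?thesis using q' uncong by (auto simp: add.assoc)
      qed
      from reflected_moves_class[OF p(3) 3(2) m(2)] show ?thesis
      proof
        assume *: "\<forall>v'\<in>{0, b}. \<forall>f'. \<bar>f'\<bar> = 1 \<and> cyc_dist N (v' + f') = cyc_dist N (v + f) \<longrightarrow>
          [v' + f' = v + f] (mod N)"
        have "vtx q = vtx p" if q: "q \<in> moves_from ?Q" "indist ?B q p" for q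
        proof -
          from q3[OF q] obtain u' v' f' where q': "q = (x + u', y + (v' + f'))" "v' \<in> {0, b}"
            "\<bar>f'\<bar> = 1" "cyc_dist N (v' + f') = cyc_dist N (v + f)" "[x + u' = x + u] (mod M)" by blast
          then have "[y + (v' + f') = y + (v + f)] (mod N)" using * uncong by blast
          then show ?thesis using q'(5) 3 by (simp add: p(1) q'(1) vtx_Pair pos_eq_iff add.assoc)
        qed
        then show ?thesis by blast
      next
        assume "\<exists>c. \<forall>z. cyc_dist N z = cyc_dist N (v + f) \<longrightarrow> [z = c] (mod N) \<or> [z = c + 2] (mod N)"
        then obtain c where c: "\<And>z. cyc_dist N z = cyc_dist N (v + f) \<Longrightarrow>
          [z = c] (mod N) \<or> [z = c + 2] (mod N)" by blast
        have "vtx q \<in> vtx ` {(x + u, y + c), (x + u, y + c + 2)}"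
          if q: "q \<in> moves_from ?Q" "indist ?B q p" for q
        proof -
          from q3[OF q] obtain u' v' f' where q': "q = (x + u', y + (v' + f'))"
            "cyc_dist N (v' + f') = cyc_dist N (v + f)" "[x + u' = x + u] (mod M)" by blast
          have "[y + (v' + f') = y + c] (mod N) \<or> [y + (v' + f') = y + (c + 2)] (mod N)"
            using c[OF q'(2)] uncong by blast
          then show ?thesis using q'(3) by (auto simp: q'(1) vtx_Pair pos_eq_iff add.assoc)
        qed
        then show ?thesis using wins_2_straight_swapped[OF M N, of "x + u" "y + c"] by blast
      qed
    qed
  qed simp
qed

text \<open>The first antipodal probes leave \<open>(x, y)\<close> and its mirror images, a
  rectangle whose sides \<open>- 2 * x\<close> and \<open>- 2 * y\<close> are even.\<close>

lemma cops_win_2_even: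
  assumes M: "even M" "M \<ge> 6" and N: "even N" "N \<ge> 6"
  shows "cops_win G 2"
proof -
  obtain k where k: "M = 2 * k" using M(1) by blast
  show ?thesis
  proof (rule cops_win_vtxI[OF distinct_even_box[OF k, of 0 0]])
    fix p :: "int \<times> int"
    obtain x y where p: "p = (x, y)" by (cases p)
    let ?Q = "{(x, y), (x + - 2 * x, y), (x, y + - 2 * y), (x + - 2 * x, y + - 2 * y)}"
    have "vtx q \<in> vtx ` ?Q" if q: "indist [(0, 0), (0 + k, 0)] q p" for q
    proof -
      obtain x' y' where q': "q = (x', y')" by (cases q)
      have "cyc_dist M x' = cyc_dist M x" "cyc_dist N y' = cyc_dist N y"
        using indist_even_box[OF k q] by (simp_all add: p q')
      then have "[x' = x] (mod M) \<or> [x' = - x] (mod M)" "[y' = y] (mod N) \<or> [y' = - y] (mod N)"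
        using M N by (simp_all add: cyc_dist_eq_iff)
      then show ?thesis by (auto simp: q' vtx_Pair pos_eq_iff)
    qed
    moreover have "wins 2 ?Q" by (rule wins_2_rectangle[OF M N]) simp_all
    ultimately show "(\<forall>q. indist [(0, 0), (0 + k, 0)] q p \<longrightarrow> vtx q = vtx p) \<or>
        (\<exists>Q. wins 2 Q \<and> (\<forall>q. indist [(0, 0), (0 + k, 0)] q p \<longrightarrow> vtx q \<in> vtx ` Q))"
      by blast
  qed simp
qed

subsection \<open>Three cops\<close>

text \<open>One turn is enough: the first two probes leave only the sign of the second coordinate
  open, and the third, adjacent to the first, decides it.\<close>

lemma cops_win_3_odd:
  assumes "odd M"
  shows "cops_win G 3"
proof -
  obtain k where M: "M = 2 * k + 1" using assms by (elim oddE)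
  have k: "k \<ge> 1" using M M3 by simp
  let ?B = "[(0, 0), (k, 0), (0, 1)]"
  have "vtx q = vtx p" if "indist ?B q p" for p q
  proof -
    obtain x y x' y' where pq: "p = (x, y)" "q = (x', y')" by (metis surj_pair)
    have x: "[x' = x] (mod M)" and "cyc_dist N y' = cyc_dist N y"
      using that cyc_dist_odd_pair[OF M k, of x' "cyc_dist N y'" x "cyc_dist N y"]
      by (simp_all add: indist_def pq)
    moreover have "cyc_dist N (y' - 1) = cyc_dist N (y - 1)"
      using that cyc_dist_cong[OF x] by (simp add: indist_def pq)
    ultimately show ?thesis
      using cyc_dist_adjacent_pair[OF N3] by (simp add: pq vtx_Pair pos_eq_iff)
  qed
  moreover have "\<not> [0 = k] (mod M)" "\<not> [k = 0] (mod M)" "\<not> [0 = 1] (mod N)"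
    using M k N3 by (simp_all add: not_cong_int)
  ultimately show ?thesis
    by (intro cops_win_vtxI[of ?B]) (auto simp: vtx_Pair pos_eq_iff)
qed

text \<open>The first turn finds the column, its third probe deciding the sign. The second turn
  probes from column \<open>x + 1\<close> and finds both coordinates.\<close>

lemma cops_win_3_even:
  assumes M: "even M" "M \<ge> 4"
  shows "cops_win G 3"
proof -
  obtain k where k: "M = 2 * k" using M(1) by blast
  have column: "wins 3 (range (Pair x))" for x
  proof (rule winsI)
    let ?B = "[(x + 1, 0), (x + 1 + k, 0), (x + 1, 1)]"
    have "\<not> [x + 1 = x + 1 + k] (mod M)" "\<not> [x + 1 + k = x + 1] (mod M)" "\<not> [0 = 1] (mod N)"
      using M k N3 by (simp_all add: not_cong_int)
    then show "distinct (map vtx ?B)" by (simp add: vtx_Pair pos_eq_iff)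
    fix p assume p: "p \<in> moves_from (range (Pair x))"
    have "vtx q = vtx p" if q: "q \<in> moves_from (range (Pair x))" "indist ?B q p" for q
    proof -
      have rep: "\<exists>e y. r = (x + e, y) \<and> \<bar>e\<bar> \<le> 1" if "r \<in> moves_from (range (Pair x))" for r
        using that by (auto simp: moves_from_def unit_moves_def)
      obtain e y where p': "p = (x + e, y)" "\<bar>e\<bar> \<le> 1" using rep[OF p] by blast
      obtain e' y' where q': "q = (x + e', y')" "\<bar>e'\<bar> \<le> 1" using rep[OF q(1)] by blast
      have "indist [(x + 1, 0), (x + 1 + k, 0)] q p" using q(2) by (simp add: indist_def)
      note d = indist_even_box[OF k this]
      \<comment> \<open>Relative to column \<open>x + 1\<close> the offsets are \<open>-2\<close>,
        \<open>-1\<close> and 0, whose distances differ because \<open>M \<ge> 4\<close>.\<close>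
      have e: "e = e'"
        using d(1) p' q' M(2) by (simp add: cyc_dist_eq abs_if min_def split: if_splits)
      have "cyc_dist N y' = cyc_dist N y" using d(2) by (simp add: p' q')
      moreover have "cyc_dist N (y' - 1) = cyc_dist N (y - 1)"
        using q(2) by (simp add: indist_def p' q' e)
      ultimately show ?thesis
        using cyc_dist_adjacent_pair[OF N3] by (simp add: p' q' e vtx_Pair pos_eq_iff)
    qed
    then show "(\<forall>q\<in>moves_from (range (Pair x)). indist ?B q p \<longrightarrow> vtx q = vtx p) \<or>
        (\<exists>Q. wins 3 Q \<and> (\<forall>q\<in>moves_from (range (Pair x)). indist ?B q p \<longrightarrow> vtx q \<in> vtx ` Q))"
      by blast
  qed simp
  let ?B = "[(0, 0), (k, 0), (1, 0)]"
  show ?thesis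
  proof (rule cops_win_vtxI)
    have "\<not> [0 = k] (mod M)" "\<not> [0 = 1] (mod M)" "\<not> [k = 1] (mod M)"
      using M k by (simp_all add: not_cong_int)
    then show "distinct (map vtx ?B)" by (simp add: vtx_Pair pos_eq_iff)
    fix p
    have "vtx q \<in> vtx ` range (Pair (fst p))" if q: "indist ?B q p" for q
    proof -
      have "indist [(0, 0), (0 + k, 0)] q p" using q by (simp add: indist_def)
      note d = indist_even_box[OF k this]
      moreover have "cyc_dist M (fst q - 1) = cyc_dist M (fst p - 1)"
        using q d by (simp add: indist_def)
      ultimately have "[fst q = fst p] (mod M)" by (intro cyc_dist_adjacent_pair[OF M3]) auto
      then have "vtx q = vtx (fst p, snd q)" by (cases q) (simp add: vtx_Pair pos_eq_iff)
      then show ?thesis by simp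
    qed
    then show "(\<forall>q. indist ?B q p \<longrightarrow> vtx q = vtx p) \<or>
        (\<exists>Q. wins 3 Q \<and> (\<forall>q. indist ?B q p \<longrightarrow> vtx q \<in> vtx ` Q))"
      using column by blast
  qed simp
qed

subsection \<open>Evading one cop\<close>

text \<open>Once \<open>u\<close> and \<open>v\<close> are confused, the closed neighbourhood of
  \<open>u\<close> alone is again in the family, so the evasion continues.\<close>

lemma not_cops_win_1: "\<not> cops_win G 1"
proof (rule not_cops_winI)
  let ?F = "range (\<lambda>p. closed_nbhd G {vtx p})"
  show "closed_nbhd G {vtx (0, 0)} \<in> ?F" by blast
  have nb: "closed_nbhd G {vtx p} = vtx ` moves_from {p}" for p
    using closed_nbhd_vtx[of "{p}"] by simp
  show "S \<subseteq> pverts G" if "S \<in> ?F" for S using that by (auto simp: nb)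
  fix S B assume S: "S \<in> ?F" and B: "valid_probe G 1 B"
  obtain x y where S': "S = closed_nbhd G {vtx (x, y)}" using S by (metis (no_types, lifting) imageE surj_pair)
  obtain b where "B = [b]" "b \<in> pverts G" using B by (auto simp: valid_probe_def length_Suc_conv)
  then obtain a c where B': "B = map vtx [(a, c)]" by (auto simp: range_vtx)
  define g where "g = (\<lambda>(e, f). cyc_dist M (x + e - a) + cyc_dist N (y + f - c))"
  define D where "D = g (0, 0)"
  have "\<bar>cyc_dist M (x + 1 - a) - cyc_dist M (x - a)\<bar> \<le> 1"
      "\<bar>cyc_dist M (x - a) - cyc_dist M (x - 1 - a)\<bar> \<le> 1"
      "\<bar>cyc_dist N (y + 1 - c) - cyc_dist N (y - c)\<bar> \<le> 1"
      "\<bar>cyc_dist N (y - c) - cyc_dist N (y - 1 - c)\<bar> \<le> 1"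
      using cyc_dist_step[of M "x - a"] cyc_dist_step[of M "x - 1 - a"]
        cyc_dist_step[of N "y - c"] cyc_dist_step[of N "y - 1 - c"] M3 N3
      by (simp_all add: algebra_simps)
  then have "\<bar>g m - D\<bar> \<le> 1" if "m \<in> unit_moves" for m
    using that by (auto simp: g_def D_def unit_moves_def)
  then have "g ` unit_moves \<subseteq> {D - 1..D + 1}" by (auto simp: abs_le_iff algebra_simps)
  then have "card (g ` unit_moves) \<le> card {D - 1..D + 1}" by (intro card_mono) auto
  then have "card (g ` unit_moves) < card unit_moves" by (simp add: unit_moves_def)
  then have "\<not> inj_on g unit_moves" using pigeonhole by blast
  then obtain m m' where m: "m \<in> unit_moves" "m' \<in> unit_moves" "m \<noteq> m'" "g m = g m'"
    by (auto simp: inj_on_def)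
  define u v where "u = (x + fst m, y + snd m)" and "v = (x + fst m', y + snd m')"
  have uv: "vtx u \<in> S" "vtx v \<in> S"
    using m(1,2) by (auto simp: S' nb u_def v_def moves_from_def)
  have ne: "vtx u \<noteq> vtx v"
  proof
    assume "vtx u = vtx v"
    then have c: "[x + fst m = x + fst m'] (mod M)" "[y + snd m = y + snd m'] (mod N)"
      by (simp_all add: u_def v_def vtx_Pair pos_eq_iff)
    \<comment> \<open>Moves differ by at most 2 in each coordinate, less than either length, so they
      lead to different vertices.\<close>
    have "\<bar>fst m - fst m'\<bar> \<le> 2" "\<bar>snd m - snd m'\<bar> \<le> 2"
      using m(1,2) by (auto simp: unit_moves_def)
    then have "x + fst m = x + fst m'" "y + snd m = y + snd m'"
      using M3 N3 cong_imp_eq_int[OF c(1)] cong_imp_eq_int[OF c(2)] by auto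
    then show False using m(3) by (simp add: prod_eq_iff)
  qed
  have "answer G B (vtx u) = answer G B (vtx v)"
    unfolding B' answer_vtx_eq_iff
    using m(4) by (simp add: indist_def u_def v_def g_def case_prod_beta)
  moreover have "closed_nbhd G {vtx u} \<subseteq> closed_nbhd G {vtx u, vtx v}" by (intro closed_nbhd_mono) auto
  ultimately show "\<exists>u\<in>S. \<exists>v\<in>S. u \<noteq> v \<and> answer G B u = answer G B v \<and>
      (\<exists>S'\<in>?F. S' \<subseteq> closed_nbhd G {u, v})"
    using uv ne by blast
qed

subsection \<open>Evading two cops\<close>

text \<open>When \<open>N = 4\<close>, these are the vertices of one checkerboard colour in two
  adjacent columns.\<close>

definition core :: "int \<Rightarrow> int \<Rightarrow> 'a set" where
  "core x y = {pos x (y + 1), pos x (y - 1), pos (x + 1) y, pos (x + 1) (y + 2)}"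

lemma closed_nbhd_pos_pair:
  "closed_nbhd G {pos x y, pos x' y'} =
    {pos x y, pos (x + 1) y, pos (x - 1) y, pos x (y + 1), pos x (y - 1),
     pos x' y', pos (x' + 1) y', pos (x' - 1) y', pos x' (y' + 1), pos x' (y' - 1)}"
  by (intro set_eqI) (simp add: closed_nbhd_def arcs)

text \<open>Two vertices of a core are opposite in one column or diagonal across the two columns.
  The closed neighbourhood of either kind of pair contains a core, and \<open>core_collision\<close>
  always yields a confused pair.\<close>

lemma not_cops_win_2_even_4:
  assumes M: "even M" and N: "N = 4"
  shows "\<not> cops_win G 2"
proof (rule not_cops_winI)
  let ?F = "range (case_prod core)"
  show "core 0 0 \<in> ?F" by force
  show "S \<subseteq> pverts G" if "S \<in> ?F" for S using that by (auto simp: core_def)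
  have wrap: "pos x (y + 2) = pos x (y - 2)" for x y
    by (simp add: pos_eq_iff N cong_iff_dvd_diff)
  have sub: "core x y \<subseteq> closed_nbhd G {pos x y, pos x (y + 2)}"
    "core x y \<subseteq> closed_nbhd G {pos x y, pos (x + 1) (y + 1)}"
    "core x y \<subseteq> closed_nbhd G {pos x y, pos (x + 1) (y - 1)}" for x y
    unfolding closed_nbhd_pos_pair core_def by (auto simp: wrap algebra_simps)
  have M0: "M > 0" using M3 by simp
  fix S B assume S: "S \<in> ?F" and B: "valid_probe G 2 B"
  obtain x y where S': "S = core x y" using S by auto
  obtain b b' where "B = [b, b']" "b \<in> pverts G" "b' \<in> pverts G"
    using B by (auto simp: valid_probe_def length_Suc_conv numeral_2_eq_2)
  then obtain a c a' c' where B': "B = map (\<lambda>(a, c). pos a c) [(a, c), (a', c')]"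
    by (auto simp: verts)
  \<comment> \<open>Evenness of \<open>M\<close> excludes equal distances of adjacent columns to a
    probe.\<close>
  have col: "cyc_dist M (x + 1 - a) = cyc_dist M (x - a) + 1 \<or>
      cyc_dist M (x + 1 - a) = cyc_dist M (x - a) - 1" for a
  proof -
    have "\<bar>cyc_dist M (x + 1 - a) - cyc_dist M (x - a)\<bar> \<le> 1"
      using cyc_dist_step[of M "x - a"] M3 by (simp add: algebra_simps)
    moreover have "even (cyc_dist M (x + 1 - a)) \<longleftrightarrow> \<not> even (cyc_dist M (x - a))"
      unfolding even_cyc_dist[OF M M0] by simp blast
    ultimately show ?thesis by presburger
  qed
  \<comment> \<open>The four patterns belong to the four heights of the probe relative to
    \<open>y\<close> modulo 4.\<close>
  have row: "(cyc_dist 4 (y + 1 - c), cyc_dist 4 (y - 1 - c), cyc_dist 4 (y - c), cyc_dist 4 (y + 2 - c))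
      \<in> {(1, 1, 0, 2), (2, 0, 1, 1), (1, 1, 2, 0), (0, 2, 1, 1)}" for c
  proof -
    have "\<exists>r\<in>{0, 1, 2, -1}. [z = r] (mod 4)" for z :: int by (simp add: cong_def, presburger)
    then obtain r where r: "[y - c = r] (mod 4)" "r \<in> {0, 1, 2, -1}" by blast
    have shift: "cyc_dist 4 (y + i - c) = cyc_dist 4 (r + i)" for i
    proof (rule cyc_dist_cong)
      have "[y - c + i = r + i] (mod 4)" using r(1) by (intro cong_add) simp_all
      then show "[y + i - c = r + i] (mod 4)" by (simp add: algebra_simps)
    qed
    have eqs: "cyc_dist 4 (y + 1 - c) = cyc_dist 4 (r + 1)" "cyc_dist 4 (y - 1 - c) = cyc_dist 4 (r - 1)"
      "cyc_dist 4 (y - c) = cyc_dist 4 r" "cyc_dist 4 (y + 2 - c) = cyc_dist 4 (r + 2)"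
      using shift[of 1] shift[of "-1"] shift[of 0] shift[of 2] by simp_all
    show ?thesis
      unfolding eqs using r(2) by (elim insertE emptyE; simp add: cyc_dist_eq)
  qed
  have ind: "answer G B (pos u v) = answer G B (pos u' v') \<longleftrightarrow>
      cyc_dist M (u - a) + cyc_dist 4 (v - c) = cyc_dist M (u' - a) + cyc_dist 4 (v' - c) \<and>
      cyc_dist M (u - a') + cyc_dist 4 (v - c') = cyc_dist M (u' - a') + cyc_dist 4 (v' - c')"
    for u v u' v'
    unfolding B' answer_pos_eq_iff by (simp add: N)
  have mem: "pos x (y + 1) \<in> S" "pos x (y - 1) \<in> S" "pos (x + 1) y \<in> S" "pos (x + 1) (y + 2) \<in> S"
    by (simp_all add: S' core_def)
  have evade: "\<exists>u\<in>S. \<exists>v\<in>S. u \<noteq> v \<and> answer G B u = answer G B v \<and>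
      (\<exists>S'\<in>?F. S' \<subseteq> closed_nbhd G {u, v})"
    if "answer G B u = answer G B v" "u \<in> S" "v \<in> S" "u \<noteq> v" "core i j \<subseteq> closed_nbhd G {u, v}" for u v i j
  proof -
    have "core i j \<in> ?F" by (rule image_eqI[of _ _ "(i, j)"]) simp_all
    with that(5) have "\<exists>S'\<in>?F. S' \<subseteq> closed_nbhd G {u, v}" by (rule bexI)
    with that(1,4) show ?thesis by (intro bexI[OF _ that(2)] bexI[OF _ that(3)] conjI)
  qed
  have ne: "pos x (y + 1) \<noteq> pos x (y - 1)" "pos (x + 1) y \<noteq> pos (x + 1) (y + 2)"
    "pos x (y + 1) \<noteq> pos (x + 1) y" "pos x (y + 1) \<noteq> pos (x + 1) (y + 2)"
    "pos x (y - 1) \<noteq> pos (x + 1) y" "pos x (y - 1) \<noteq> pos (x + 1) (y + 2)"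
    by (simp_all add: pos_eq_iff N not_cong_int)
  have cores: "core x (y - 1) \<subseteq> closed_nbhd G {pos x (y - 1), pos x (y + 1)}"
    "core (x + 1) y \<subseteq> closed_nbhd G {pos (x + 1) y, pos (x + 1) (y + 2)}"
    "core x (y + 1) \<subseteq> closed_nbhd G {pos x (y + 1), pos (x + 1) y}"
    "core x (y + 1) \<subseteq> closed_nbhd G {pos x (y + 1), pos (x + 1) (y + 2)}"
    "core x (y - 1) \<subseteq> closed_nbhd G {pos x (y - 1), pos (x + 1) y}"
    "core x (y - 1) \<subseteq> closed_nbhd G {pos x (y - 1), pos (x + 1) (y + 2)}"
    using sub(1)[of x "y - 1"] sub(1)[of "x + 1" y] sub(3)[of x "y + 1"] sub(2)[of x "y + 1"]
      sub(2)[of x "y - 1"] sub(3)[of x "y - 1"] wrap[of "x + 1" y]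
    by (simp_all add: add.commute)
  have "answer G B (pos x (y + 1)) = answer G B (pos x (y - 1)) \<or>
      answer G B (pos (x + 1) y) = answer G B (pos (x + 1) (y + 2)) \<or>
      answer G B (pos x (y + 1)) = answer G B (pos (x + 1) y) \<or>
      answer G B (pos x (y + 1)) = answer G B (pos (x + 1) (y + 2)) \<or>
      answer G B (pos x (y - 1)) = answer G B (pos (x + 1) y) \<or>
      answer G B (pos x (y - 1)) = answer G B (pos (x + 1) (y + 2))"
    unfolding ind by (rule core_collision[OF row row col col])
  then consider "answer G B (pos x (y + 1)) = answer G B (pos x (y - 1))"
    | "answer G B (pos (x + 1) y) = answer G B (pos (x + 1) (y + 2))"
    | "answer G B (pos x (y + 1)) = answer G B (pos (x + 1) y)"
    | "answer G B (pos x (y + 1)) = answer G B (pos (x + 1) (y + 2))"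
    | "answer G B (pos x (y - 1)) = answer G B (pos (x + 1) y)"
    | "answer G B (pos x (y - 1)) = answer G B (pos (x + 1) (y + 2))"
    by blast
  then show "\<exists>u\<in>S. \<exists>v\<in>S. u \<noteq> v \<and> answer G B u = answer G B v \<and>
      (\<exists>S'\<in>?F. S' \<subseteq> closed_nbhd G {u, v})"
  proof cases
    case 1
    show ?thesis by (rule evade[OF 1[symmetric] mem(2,1) ne(1)[symmetric] cores(1)])
  next
    case 2
    show ?thesis by (rule evade[OF 2 mem(3,4) ne(2) cores(2)])
  next
    case 3
    show ?thesis by (rule evade[OF 3 mem(1,3) ne(3) cores(3)])
  next
    case 4
    show ?thesis by (rule evade[OF 4 mem(1,4) ne(4) cores(4)])
  next
    case 5
    show ?thesis by (rule evade[OF 5 mem(2,3) ne(5) cores(5)])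
  next
    case 6
    show ?thesis by (rule evade[OF 6 mem(2,4) ne(6) cores(6)])
  qed
qed

text \<open>The sets of at least seven vertices form the evading family: six possible answers force
  a confusion in such a set, and two distinct vertices have at least seven vertices in their closed
  neighbourhood.\<close>

lemma not_cops_win_2_3_3:
  assumes M: "M = 3" and N: "N = 3"
  shows "\<not> cops_win G 2"
proof (rule not_cops_winI)
  let ?F = "{S. S \<subseteq> pverts G \<and> card S \<ge> 7}"
  let ?I = "{0, 1, 2 :: int}"
  have inj: "inj_on (\<lambda>(i, j). pos (x + i) (y + j)) (?I \<times> ?I)" for x y
  proof (rule inj_onI, clarify)
    fix i j i' j' assume I: "i \<in> ?I" "j \<in> ?I" "i' \<in> ?I" "j' \<in> ?I"
      and "pos (x + i) (y + j) = pos (x + i') (y + j')"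
    then have c: "[x + i = x + i'] (mod 3)" "[y + j = y + j'] (mod 3)"
      by (simp_all add: pos_eq_iff M N)
    have "\<bar>i - i'\<bar> < 3" "\<bar>j - j'\<bar> < 3" using I by auto
    then show "i = i' \<and> j = j'" using cong_imp_eq_int[OF c(1)] cong_imp_eq_int[OF c(2)] by simp
  qed
  have rep: "\<exists>i\<in>?I. [z = w + i] (mod 3)" for z w :: int
  proof (intro bexI)
    show "[z = w + (z - w) mod 3] (mod 3)" by (simp add: cong_def mod_add_right_eq)
    show "(z - w) mod 3 \<in> ?I" by (simp, presburger)
  qed
  have line: "[i = j] (mod 3) \<or> [i = j + 1] (mod 3) \<or> [i = j - 1] (mod 3)" for i j :: int
    unfolding cong_def by presburger
  have nbhd: "7 \<le> card (closed_nbhd G {u, v})" if uv: "u \<noteq> v" "u \<in> pverts G" "v \<in> pverts G" for u v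
  proof -
    obtain x y x' y' where u: "u = pos x y" and v: "v = pos x' y'" using uv verts by blast
    obtain i0 j0 where ij: "i0 \<in> ?I" "j0 \<in> ?I" "[x' = x + i0] (mod 3)" "[y' = y + j0] (mod 3)"
      using rep by meson
    have v': "v = pos (x + i0) (y + j0)" using ij by (simp add: v pos_eq_iff M N)
    have "i0 \<noteq> 0 \<or> j0 \<noteq> 0" using uv(1) by (auto simp: u v')
    \<comment> \<open>In a triangle all vertices are adjacent, so a closed neighbourhood is a full
      row and column. \<open>C\<close> is what the two crosses miss; one factor is a singleton
      because \<open>i0\<close> or \<open>j0\<close> is nonzero.\<close>
    define C where "C = (?I - {0, i0}) \<times> (?I - {0, j0})"
    have C: "card C \<le> 2" "C \<subseteq> ?I \<times> ?I"
      using ij(1,2) \<open>i0 \<noteq> 0 \<or> j0 \<noteq> 0\<close> by (auto simp: C_def card_cartesian_product insert_Diff_if)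
    have "card (?I \<times> ?I - C) = card (?I \<times> ?I) - card C"
      using C(2) by (intro card_Diff_subset) (auto intro: finite_subset)
    then have "7 \<le> card (?I \<times> ?I - C)" using C(1) by (simp add: card_cartesian_product)
    also have "\<dots> = card ((\<lambda>(i, j). pos (x + i) (y + j)) ` (?I \<times> ?I - C))"
      by (rule card_image[symmetric]) (rule inj_on_subset[OF inj], blast)
    also have "\<dots> \<le> card (closed_nbhd G {u, v})"
    proof (rule card_mono)
      show "finite (closed_nbhd G {u, v})" by (simp add: u v closed_nbhd_pos_pair)
      have in_line: "pos a' b \<in> closed_nbhd G {pos a b, w}" "pos a b' \<in> closed_nbhd G {pos a b, w}"
        for a a' b b' w
        using line[of a' a] line[of b' b]
        by (auto simp: closed_nbhd_def arcs pos_eq_iff M N)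
      have in_line': "pos a' b \<in> closed_nbhd G {w, pos a b}" "pos a b' \<in> closed_nbhd G {w, pos a b}"
        for a a' b b' w
        using in_line(1)[of a' b a w] in_line(2)[of a b' b w] by (simp_all add: insert_commute)
      show "(\<lambda>(i, j). pos (x + i) (y + j)) ` (?I \<times> ?I - C) \<subseteq> closed_nbhd G {u, v}"
      proof (intro subsetI, elim imageE)
        fix w p assume w: "w = (\<lambda>(i, j). pos (x + i) (y + j)) p" and p: "p \<in> ?I \<times> ?I - C"
        obtain i j where p': "p = (i, j)" by (cases p)
        have "i = 0 \<or> j = 0 \<or> i = i0 \<or> j = j0" using p by (auto simp: p' C_def)
        then show "w \<in> closed_nbhd G {u, v}"
          using in_line(1)[of "x + i" y x v] in_line(2)[of x "y + j" y v]
            in_line'(1)[of "x + i" "y + j0" u "x + i0"] in_line'(2)[of "x + i0" "y + j" u "y + j0"]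
          by (auto simp: w p' u v')
      qed
    qed
    finally show ?thesis .
  qed
  have fin: "finite (pverts G)"
  proof -
    interpret pair_graph G by (rule graph)
    show ?thesis by (rule pair_finite_verts)
  qed
  have "pos 0 0 \<noteq> pos 1 0" by (simp add: pos_eq_iff M cong_def)
  then have "7 \<le> card (closed_nbhd G {pos 0 0, pos 1 0})" by (intro nbhd) auto
  also have "\<dots> \<le> card (pverts G)"
    using fin by (intro card_mono) (auto simp: closed_nbhd_pos_pair)
  finally show "pverts G \<in> ?F" by simp
  show "S \<subseteq> pverts G" if "S \<in> ?F" for S using that by simp
  fix S B assume S: "S \<in> ?F" and B: "valid_probe G 2 B"
  obtain b b' where B': "B = [b, b']" and b: "b \<in> pverts G" "b' \<in> pverts G"
    using B by (auto simp: valid_probe_def length_Suc_conv numeral_2_eq_2)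
  have dist: "w = b \<or> graph_dist G w b \<in> {1, 2}" if "w \<in> pverts G" "b \<in> pverts G" for w b
  proof -
    from that obtain x y a c where w: "w = pos x y" and b: "b = pos a c" using verts by blast
    have "cyc_dist 3 z \<in> {0, 1}" for z
    proof -
      have "z mod 3 \<in> ?I" by (simp, presburger)
      moreover have "cyc_dist 3 z = cyc_dist 3 (z mod 3)" by (rule cyc_dist_cong) (simp add: cong_def)
      ultimately show ?thesis by (auto simp: cyc_dist_eq)
    qed
    from this[of "x - a"] this[of "y - c"] show ?thesis
      using cyc_dist_eq_0_iff[of 3 "x - a"] cyc_dist_eq_0_iff[of 3 "y - c"]
      by (auto simp: w b graph_dist_pos pos_eq_iff M N cong_diff_iff_cong_0)
  qed
  \<comment> \<open>Only \<open>b\<close> and \<open>b'\<close> themselves produce a 0; every other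
    answer has both entries in \<open>{1, 2}\<close>.\<close>
  have "answer G B ` S \<subseteq> {answer G B b, answer G B b', [1, 1], [1, 2], [2, 1], [2, 2]}"
  proof (intro image_subsetI)
    fix w assume "w \<in> S"
    then have "w \<in> pverts G" using S by blast
    then show "answer G B w \<in> {answer G B b, answer G B b', [1, 1], [1, 2], [2, 1], [2, 2]}"
      using dist[of w b] dist[of w b'] b by (auto simp: answer_def B')
  qed
  then have "card (answer G B ` S) \<le> card {answer G B b, answer G B b', [1, 1], [1, 2], [2, 1], [2, 2]}"
    by (intro card_mono) auto
  also have "\<dots> \<le> 6" by (intro card_insert_le_m1[THEN order_trans]) auto
  finally have "card (answer G B ` S) < card S" using S by simp
  then have "\<not> inj_on (answer G B) S" using pigeonhole by blast
  then obtain u v where uv: "u \<in> S" "v \<in> S" "u \<noteq> v" "answer G B u = answer G B v"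
    by (auto simp: inj_on_def)
  have uvV: "u \<in> pverts G" "v \<in> pverts G" using S uv by auto
  then have "closed_nbhd G {u, v} \<subseteq> pverts G" by (auto simp: closed_nbhd_pos_pair elim!: posE)
  then have "closed_nbhd G {u, v} \<in> ?F" using nbhd[OF uv(3) uvV] by simp
  then show "\<exists>u\<in>S. \<exists>v\<in>S. u \<noteq> v \<and> answer G B u = answer G B v \<and>
      (\<exists>S'\<in>?F. S' \<subseteq> closed_nbhd G {u, v})"
    using uv by blast
qed

end

section \<open>Determination of the localization number\<close>

lemma localization_number_eqI:
  assumes "k \<ge> 1" "cops_win G k" "\<And>j. 1 \<le> j \<Longrightarrow> j < k \<Longrightarrow> \<not> cops_win G j"
  shows "localization_number G = k"
  unfolding localization_number_def
  by (rule Least_equality) (use assms not_less in blast)+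


theorem theorem5p7:
  fixes m n :: nat
  assumes "m \<ge> n" and "n \<ge> 3"
  shows "((m = 3 \<and> n = 3) \<or> (even m \<and> n = 4) \<longrightarrow>
            localization_number (cycle_graph m \<box> cycle_graph n) = 3) \<and>
         (\<not> ((m = 3 \<and> n = 3) \<or> (even m \<and> n = 4)) \<longrightarrow>
            localization_number (cycle_graph m \<box> cycle_graph n) = 2)"
proof -
  let ?G = "cycle_graph m \<box> cycle_graph n"
  interpret T: torus ?G "\<lambda>x y. (nat (x mod int m), nat (y mod int n))" "int m" "int n"
    using assms by (intro torus_cycle_graphs) auto
  \<comment> \<open>With exchanged coordinates the cycle of order \<open>n\<close> takes the role of
    the odd cycle.\<close>
  interpret S: torus ?G "\<lambda>x y. (nat (y mod int m), nat (x mod int n))" "int n" "int m"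
    by (rule T.swap)
  have three: "localization_number ?G = 3" if "cops_win ?G 3" "\<not> cops_win ?G 2"
  proof (rule localization_number_eqI)
    show "\<not> cops_win ?G j" if "1 \<le> j" "j < 3" for j
    proof -
      have "j = 1 \<or> j = 2" using that by linarith
      then show ?thesis using T.not_cops_win_1 \<open>\<not> cops_win ?G 2\<close> by blast
    qed
  qed (use that in simp_all)
  have two: "localization_number ?G = 2" if "cops_win ?G 2"
  proof (rule localization_number_eqI)
    show "\<not> cops_win ?G j" if "1 \<le> j" "j < 2" for j
    proof -
      have "j = 1" using that by linarith
      then show ?thesis using T.not_cops_win_1 by blast
    qed
  qed (use that in simp_all)
  show ?thesis
  proof (intro conjI impI)
    assume "(m = 3 \<and> n = 3) \<or> (even m \<and> n = 4)"
    then show "localization_number ?G = 3"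
    proof
      assume "m = 3 \<and> n = 3"
      then show ?thesis using T.cops_win_3_odd T.not_cops_win_2_3_3 by (intro three) simp_all
    next
      assume "even m \<and> n = 4"
      then show ?thesis
        using T.cops_win_3_even T.not_cops_win_2_even_4 assms(1) by (intro three) simp_all
    qed
  next
    assume not_special: "\<not> ((m = 3 \<and> n = 3) \<or> (even m \<and> n = 4))"
    consider "odd n" | "odd m" "even n" | "even m" "even n" by blast
    then have "cops_win ?G 2"
    proof cases
      case 1
      have "n \<noteq> 4" using 1 by auto
      \<comment> \<open>\<open>m = 3\<close> would force \<open>n = 3\<close>, an excluded
        case.\<close>
      then have "m \<ge> 4" using not_special assms by linarith
      then show ?thesis using S.cops_win_2_odd 1 by simp
    next
      case 2
      have "n \<noteq> 3" using 2 by auto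
      then show ?thesis using T.cops_win_2_odd 2 assms by simp
    next
      case 3
      have "n \<noteq> 3" "n \<noteq> 4" "n \<noteq> 5" using 3 not_special by auto
      then have "n \<ge> 6" using assms by linarith
      then show ?thesis using T.cops_win_2_even 3 assms by simp
    qed
    then show "localization_number ?G = 2" by (rule two)
  qed
qed

end
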